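(* Assume that $$\frac{\mathbb{E}(\varepsilon)}{c}\int_0^1 u^{\frac{1+b}{c}-1}\exp\Big\{\frac1c\int_u^1\frac{g_\varepsilon(v)}{v}\,dv\Big\}\,du>1 .$$ Then the probability that the random cherry tree process becomes extinct (that is, eventually all its edges are deleted) is equal to the smallest nonnegative root $z$ of the equation $$\frac{1-g_\varepsilon(z)}{c}\int_0^1 u^{\frac{1+b}{c}-1}\exp\Big\{\int_u^1 g_\varepsilon(sz)\,ds\Big\}\,du=1-z .$$
   Context: Parameters: constants $b,c>0$ and $p\in[0,1]$; a positive integer valued random variable $\kappa$ with $g_\kappa(z)=\mathbb{E}(z^\kappa)<\infty$ for every $z\in\mathbb{R}$; $\varepsilon=\sum_{i=1}^{\kappa}\varphi_i$, where $\varphi_1,\varphi_2,\dots$ are iid, independent of $\kappa$, with $\mathbb{P}(\varphi_i=2)=p$, $\mathbb{P}(\varphi_i=1)=1-p$; $g_\varepsilon(z)=\mathbb{E}(z^\varepsilon)$. Life of an edge: let $(\pi(t))_{t\ge0}$ be a homogeneous Poisson process of unit intensity (birth events), and let $(\kappa_i,\varepsilon_i)$, $i\ge1$, be iid copies of $(\kappa,\varepsilon)$, independent of $\pi$. Put $B_k=\varepsilon_1+\dots+\varepsilon_k$. The life span $\lambda$ of the edge is a positive random variable with $\mathbb{P}(\lambda>t\mid \pi,(\kappa_i,\varepsilon_i)_{i\ge1})=\exp\big(-\int_0^t(b+cB_{\pi(s)})\,ds\big)$. The number of new edges born to the edge up to its age $t$ is $\xi(t)=B_{\pi(t\wedge\lambda)}$.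 (Continuous time) random cherry tree: at time $0$ there is one edge joining two vertices. Every edge, from its birth on, lives according to its own independent copy of $(\pi,(\kappa_i,\varepsilon_i)_{i\ge1},\lambda)$ (Poisson process of birth events, numbers of new vertices and edges at these events, life span): at its $i$-th birth event (while alive) $\kappa_i$ new vertices are added to the graph, each of them being joined to both endpoints of the edge if the corresponding $\varphi=2$ (a cherry) or to one randomly chosen endpoint of the edge if the corresponding $\varphi=1$ (a semi-cherry); thus $\varepsilon_i$ new edges are born. The edge is deleted when its age reaches its life span $\lambda$. The discrete time random cherry tree is the sequence of graphs observed at the successive events (births or deletions) of this process, so its extinction probability is the same.
   Formalization: The exponent in the equation for z is corrected from ∫_u^1 g_ε(sz) ds to (1/c)∫_u^1 g_ε(sz)/s ds; as printed the claim fails, e.g. for κ=1, p=0, c=1, b=0.1. *)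

theory Defs
  imports "HOL-Probability.Probability"
begin

section \<open>The law of the number of new edges at a birth event\<close>

text \<open>
  \<^term>\<open>\<kappa>\<close> is the law of the number of new vertices.  A new vertex is a cherry (2 new edges)
  with probability \<^term>\<open>p\<close>, otherwise a semi-cherry (1 new edge).
\<close>

definition phi_pmf :: "real \<Rightarrow> nat pmf" where
  "phi_pmf p = map_pmf (\<lambda>cherry. if cherry then 2 else 1) (bernoulli_pmf p)"

definition eps_pmf :: "nat pmf \<Rightarrow> real \<Rightarrow> nat pmf" where
  "eps_pmf \<kappa> p =
     bind_pmf \<kappa> (\<lambda>k. map_pmf (\<lambda>\<phi>. \<Sum>j<k. \<phi> j) (Pi_pmf {..<k} 0 (\<lambda>_. phi_pmf p)))"

definition gen_fun :: "nat pmf \<Rightarrow> real \<Rightarrow> real" where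
  "gen_fun q z = measure_pmf.expectation q (\<lambda>n. z ^ n)"


section \<open>Independence of random variables with different value types\<close>

text \<open>The library's \<open>indep_var\<close> requires both variables to have values in the same type.\<close>

definition (in prob_space) indep_pair ::
  "'b measure \<Rightarrow> ('a \<Rightarrow> 'b) \<Rightarrow> 'c measure \<Rightarrow> ('a \<Rightarrow> 'c) \<Rightarrow> bool" where
  "indep_pair S X T Y \<longleftrightarrow>
     random_variable S X \<and> random_variable T Y \<and>
     indep_set (sets (vimage_algebra (space M) X S)) (sets (vimage_algebra (space M) Y T))"


section \<open>Unit intensity Poisson process\<close>

definition (in prob_space) unit_poisson_process :: "(real \<Rightarrow> 'a \<Rightarrow> nat) \<Rightarrow> bool" where
  "unit_poisson_process \<pi> \<longleftrightarrow>
     (\<forall>t\<ge>0. random_variable (count_space UNIV) (\<pi> t)) \<and>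
     (\<forall>\<omega>\<in>space M. \<pi> 0 \<omega> = 0 \<and> mono_on {0..} (\<lambda>t. \<pi> t \<omega>) \<and>
        (\<forall>t\<ge>0. continuous (at_right t) (\<lambda>s. \<pi> s \<omega>))) \<and>
     (\<forall>s t. 0 \<le> s \<longrightarrow> s < t \<longrightarrow>
        distr M (count_space UNIV) (\<lambda>\<omega>. \<pi> t \<omega> - \<pi> s \<omega>) = measure_pmf (poisson_pmf (t - s))) \<and>
     (\<forall>n (t :: nat \<Rightarrow> real). 0 \<le> t 0 \<longrightarrow> mono t \<longrightarrow>
        indep_vars (\<lambda>_. count_space UNIV) (\<lambda>i \<omega>. \<pi> (t (Suc i)) \<omega> - \<pi> (t i) \<omega>) {..<n})"


section \<open>The life of an edge\<close>

text \<open>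
  Birth events and the vertices added at an event are numbered from 0: \<open>K i\<close> is the number of
  vertices added at event \<open>i\<close>, and \<open>\<phi> i j\<close> for \<open>j < K i\<close> says whether vertex \<open>j\<close> of that event is
  a cherry (value 2) or a semi-cherry (value 1).
\<close>

abbreviation path_space :: "(real \<Rightarrow> nat) measure" where
  "path_space \<equiv> PiM {0..} (\<lambda>_. count_space UNIV)"

abbreviation mark_space :: "(nat \<times> (nat \<Rightarrow> nat)) measure" where
  "mark_space \<equiv> count_space UNIV \<Otimes>\<^sub>M PiM UNIV (\<lambda>_. count_space UNIV)"

definition path :: "(real \<Rightarrow> 'a \<Rightarrow> nat) \<Rightarrow> 'a \<Rightarrow> real \<Rightarrow> nat" where
  "path \<pi> \<omega> = restrict (\<lambda>t. \<pi> t \<omega>) {0..}"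

definition mark :: "(nat \<Rightarrow> 'a \<Rightarrow> nat) \<Rightarrow> (nat \<Rightarrow> nat \<Rightarrow> 'a \<Rightarrow> nat) \<Rightarrow> nat \<Rightarrow> 'a \<Rightarrow> nat \<times> (nat \<Rightarrow> nat)" where
  "mark K \<phi> i \<omega> = (K i \<omega>, \<lambda>j. \<phi> i j \<omega>)"

definition new_edges :: "(nat \<Rightarrow> 'a \<Rightarrow> nat) \<Rightarrow> (nat \<Rightarrow> nat \<Rightarrow> 'a \<Rightarrow> nat) \<Rightarrow> nat \<Rightarrow> 'a \<Rightarrow> nat" where
  "new_edges K \<phi> i \<omega> = (\<Sum>j<K i \<omega>. \<phi> i j \<omega>)"

text \<open>\<open>total_edges K \<phi> k\<close> is the partial sum $B_k$.\<close>

definition total_edges :: "(nat \<Rightarrow> 'a \<Rightarrow> nat) \<Rightarrow> (nat \<Rightarrow> nat \<Rightarrow> 'a \<Rightarrow> nat) \<Rightarrow> nat \<Rightarrow> 'a \<Rightarrow> nat" where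
  "total_edges K \<phi> k \<omega> = (\<Sum>i<k. new_edges K \<phi> i \<omega>)"

text \<open>
  The sigma-algebra on which the conditional law of the life span is prescribed: it is generated
  by the Poisson process and the pairs (number of new vertices, number of new edges).
\<close>

definition history ::
  "'a measure \<Rightarrow> (real \<Rightarrow> 'a \<Rightarrow> nat) \<Rightarrow> (nat \<Rightarrow> 'a \<Rightarrow> nat) \<Rightarrow> (nat \<Rightarrow> nat \<Rightarrow> 'a \<Rightarrow> nat) \<Rightarrow> 'a measure" where
  "history M \<pi> K \<phi> =
     vimage_algebra (space M) (\<lambda>\<omega>. (path \<pi> \<omega>, \<lambda>i. (K i \<omega>, new_edges K \<phi> i \<omega>)))
       (path_space \<Otimes>\<^sub>M PiM UNIV (\<lambda>_. count_space UNIV))"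

locale edge_life = prob_space M
  for M :: "'a measure" +
  fixes b c p :: real and \<kappa> :: "nat pmf"
    and \<pi> :: "real \<Rightarrow> 'a \<Rightarrow> nat"
    and K :: "nat \<Rightarrow> 'a \<Rightarrow> nat"
    and \<phi> :: "nat \<Rightarrow> nat \<Rightarrow> 'a \<Rightarrow> nat"
    and L :: "'a \<Rightarrow> real"
  assumes poisson: "unit_poisson_process \<pi>"
    and K_law: "\<And>i. distr M (count_space UNIV) (K i) = measure_pmf \<kappa>"
    and \<phi>_law: "\<And>i j. distr M (count_space UNIV) (\<phi> i j) = measure_pmf (phi_pmf p)"
    and \<phi>_indep: "\<And>i. indep_vars (\<lambda>_. count_space UNIV) (\<phi> i) UNIV"
    and K_\<phi>_indep: "\<And>i. indep_pair (count_space UNIV) (K i)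
                            (PiM UNIV (\<lambda>_. count_space UNIV)) (\<lambda>\<omega> j. \<phi> i j \<omega>)"
    and marks_indep: "indep_vars (\<lambda>_. mark_space) (mark K \<phi>) UNIV"
    and path_marks_indep: "indep_pair path_space (path \<pi>)
                             (PiM UNIV (\<lambda>_. mark_space)) (\<lambda>\<omega> i. mark K \<phi> i \<omega>)"
    and L_measurable: "random_variable borel L"
    and L_pos: "\<And>\<omega>. \<omega> \<in> space M \<Longrightarrow> 0 < L \<omega>"
    and L_law: "\<And>t. 0 \<le> t \<Longrightarrow>
          AE \<omega> in M. real_cond_exp M (history M \<pi> K \<phi>) (indicator {\<omega> \<in> space M. t < L \<omega>}) \<omega>
            = exp (- (LBINT s=0..t. b + c * real (total_edges K \<phi> (\<pi> s \<omega>) \<omega>)))"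


section \<open>The random cherry tree\<close>

text \<open>
  Edges are labelled by their line of descent, the most recent birth first: \<open>(i, j, r) # e\<close> joins
  vertex \<open>j\<close> added at birth event \<open>i\<close> of the edge \<open>e\<close> to the endpoint \<open>r\<close> of \<open>e\<close>, and \<open>[]\<close> is the
  initial edge.  Endpoint \<open>True\<close> of an edge is the vertex born together with it.
\<close>

type_synonym edge = "(nat \<times> nat \<times> bool) list"

datatype vertex = Initial bool | Added edge nat nat

fun endpoint :: "edge \<Rightarrow> bool \<Rightarrow> vertex" where
  "endpoint [] r = Initial r"
| "endpoint ((i, j, r') # e) r = (if r then Added e i j else endpoint e r')"

text \<open>
  Every potential edge \<open>e\<close> carries its own \<open>\<pi> e\<close>, \<open>K e\<close>, \<open>\<phi> e\<close>, \<open>L e\<close>; \<open>s e i j\<close> is the endpoint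
  of \<open>e\<close> chosen for vertex \<open>j\<close> of event \<open>i\<close> if that vertex is a semi-cherry.
\<close>

locale cherry_data =
  fixes \<pi> :: "edge \<Rightarrow> real \<Rightarrow> 'a \<Rightarrow> nat"
    and K :: "edge \<Rightarrow> nat \<Rightarrow> 'a \<Rightarrow> nat"
    and \<phi> :: "edge \<Rightarrow> nat \<Rightarrow> nat \<Rightarrow> 'a \<Rightarrow> nat"
    and s :: "edge \<Rightarrow> nat \<Rightarrow> nat \<Rightarrow> 'a \<Rightarrow> bool"
    and L :: "edge \<Rightarrow> 'a \<Rightarrow> real"
begin

definition event_age :: "edge \<Rightarrow> nat \<Rightarrow> 'a \<Rightarrow> real" where
  "event_age e i \<omega> = Inf {t. 0 \<le> t \<and> i < \<pi> e t \<omega>}"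

text \<open>Event \<open>i\<close> falls into the life of \<open>e\<close> and at least \<open>j + 1\<close> vertices are added at it.\<close>

definition adds_vertex :: "edge \<Rightarrow> nat \<Rightarrow> nat \<Rightarrow> 'a \<Rightarrow> bool" where
  "adds_vertex e i j \<omega> \<longleftrightarrow> i < \<pi> e (L e \<omega>) \<omega> \<and> j < K e i \<omega>"

fun ever_born :: "'a \<Rightarrow> edge \<Rightarrow> bool" where
  "ever_born \<omega> [] \<longleftrightarrow> True"
| "ever_born \<omega> ((i, j, r) # e) \<longleftrightarrow>
     ever_born \<omega> e \<and> adds_vertex e i j \<omega> \<and> (\<phi> e i j \<omega> = 2 \<or> s e i j \<omega> = r)"

fun birth_time :: "'a \<Rightarrow> edge \<Rightarrow> real" where
  "birth_time \<omega> [] = 0"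
| "birth_time \<omega> ((i, j, r) # e) = birth_time \<omega> e + event_age e i \<omega>"

definition alive_edges :: "real \<Rightarrow> 'a \<Rightarrow> edge set" where
  "alive_edges t \<omega> =
     {e. ever_born \<omega> e \<and> birth_time \<omega> e \<le> t \<and> t < birth_time \<omega> e + L e \<omega>}"

definition graph_vertices :: "real \<Rightarrow> 'a \<Rightarrow> vertex set" where
  "graph_vertices t \<omega> =
     range Initial \<union>
     {Added e i j | e i j. ever_born \<omega> e \<and> adds_vertex e i j \<omega> \<and>
                           birth_time \<omega> e + event_age e i \<omega> \<le> t}"

definition graph_edges :: "real \<Rightarrow> 'a \<Rightarrow> vertex set set" where
  "graph_edges t \<omega> = (\<lambda>e. range (endpoint e)) ` alive_edges t \<omega>"

text \<open>The graph present at time \<open>t\<close>, as a pair (vertices, edges).\<close>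

definition cherry_tree :: "real \<Rightarrow> 'a \<Rightarrow> vertex set \<times> vertex set set" where
  "cherry_tree t \<omega> = (graph_vertices t \<omega>, graph_edges t \<omega>)"

definition extinct :: "'a \<Rightarrow> bool" where
  "extinct \<omega> \<longleftrightarrow> (\<exists>T\<ge>0. \<forall>t\<ge>T. snd (cherry_tree t \<omega>) = {})"

end

locale random_cherry_tree = prob_space M + cherry_data \<pi> K \<phi> s L
  for M :: "'a measure" and b c p :: real and \<kappa> :: "nat pmf"
    and \<pi> :: "edge \<Rightarrow> real \<Rightarrow> 'a \<Rightarrow> nat"
    and K :: "edge \<Rightarrow> nat \<Rightarrow> 'a \<Rightarrow> nat"
    and \<phi> :: "edge \<Rightarrow> nat \<Rightarrow> nat \<Rightarrow> 'a \<Rightarrow> nat"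
    and s :: "edge \<Rightarrow> nat \<Rightarrow> nat \<Rightarrow> 'a \<Rightarrow> bool"
    and L :: "edge \<Rightarrow> 'a \<Rightarrow> real" +
  assumes edge_life: "\<And>e. edge_life M b c p \<kappa> (\<pi> e) (K e) (\<phi> e) (L e)"
    and lives_indep:
      "indep_vars (\<lambda>_. path_space \<Otimes>\<^sub>M (PiM UNIV (\<lambda>_. mark_space) \<Otimes>\<^sub>M borel))
         (\<lambda>e \<omega>. (path (\<pi> e) \<omega>, (\<lambda>i. mark (K e) (\<phi> e) i \<omega>), L e \<omega>)) UNIV"
    and choice_law:
      "\<And>e i j. distr M (count_space UNIV) (s e i j) = measure_pmf (bernoulli_pmf (1 / 2))"
    and choices_indep: "indep_vars (\<lambda>_. count_space UNIV) (\<lambda>(e, i, j). s e i j) UNIV"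
    and lives_choices_indep:
      "indep_pair
         (PiM UNIV (\<lambda>_. path_space \<Otimes>\<^sub>M (PiM UNIV (\<lambda>_. mark_space) \<Otimes>\<^sub>M borel)))
         (\<lambda>\<omega> e. (path (\<pi> e) \<omega>, (\<lambda>i. mark (K e) (\<phi> e) i \<omega>), L e \<omega>))
         (PiM UNIV (\<lambda>_. count_space UNIV))
         (\<lambda>\<omega> (e, i, j). s e i j \<omega>)"

end

theory Submission
  imports Defs
begin

text \<open>
  Write \<open>B\<^sub>t\<close> for the number of edges that the birth events up to age \<open>t\<close> would give to an edge,
  \<open>\<lambda>\<close> for its life span, \<open>N\<close> for the number of its children, the value of \<open>B\<close> at age \<open>\<lambda>\<close>, and
  \<open>G z = E(z^N)\<close>.  The proof has two independent halves.

  \<^emph>\<open>The offspring.\<close>  Let \<open>f t\<close> be the expectation of \<open>z\<close> to the power \<open>B\<^sub>t\<close> on the event that the edge is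
  alive at age \<open>t\<close>.  Conditioning on the history turns this event into the factor
  \<open>exp (- b t - c \<integral> B\<^sub>s ds)\<close>.  If the integral is replaced by a Riemann sum, then by summation by parts
  the variable is a product of powers of increments of the compound Poisson process \<open>B\<close>, which are
  independent; this gives \<open>f t = exp (- b t + \<integral> (g (z exp (- c (t - s))) - 1) ds)\<close> in the limit
  (lemmas \<open>increments_pgf\<close>, \<open>laplace_edges_at\<close> and \<open>survival_pgf\<close>).  During a short time \<open>h\<close> the variable
  \<open>z^B\<close> of a living edge is multiplied by \<open>exp (h (g z - 1))\<close> on average, and it stays constant after death; adding
  up these changes yields \<open>G z = 1 - (1 - g z) \<integral> f\<close>, also in a version restricted to \<open>\<lambda> \<le> T\<close>
  (\<open>offspring_pgf\<close>).  The substitution \<open>u = exp (- c t)\<close> turns \<open>\<integral> f\<close> into the integral of the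
  theorem (\<open>offspring_pgf_formula\<close>), so that its equation is \<open>G z = z\<close> for \<open>z\<close> in the unit interval.

  \<^emph>\<open>The branching process.\<close>  If only finitely many edges are ever born, then the process is extinct.
  For the converse one has to exclude that infinitely many edges are born and are gone by a finite time \<open>T\<close>.
  In that case all of them live at most \<open>T\<close>.  Let \<open>H\<close> be the generating function of \<open>N\<close> on the event
  \<open>\<lambda> \<le> T\<close>.  The probability that all edges of the first \<open>n\<close> generations live at most \<open>T\<close> is the
  \<open>n\<close>-th iterate of \<open>H\<close> at 1, and the probability that moreover the \<open>n\<close>-th generation is empty
  is the iterate at 0 (\<open>prob_short_lived\<close>).  As \<open>H\<close> is convex with \<open>H 1 < 1\<close>, it has exactly one fixed point
  in the unit interval, and both sequences converge to it
  (\<open>iterates_converge_to_unique_fixpoint\<close>).  Hence up to a null set the two events agree in the limit, and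
  neither explosion of the process nor the birth times have to be studied.  For \<open>T\<close> tending to
  infinity these fixed points increase to the extinction probability, which is therefore the least fixed
  point of \<open>G\<close> (\<open>prob_extinct_least_fixpoint\<close>).

  The endpoints chosen by the semi-cherries influence which labels the children get, but not their number.  Since
  the choices are independent of the lives, they can be fixed throughout the recursion.
\<close>


section \<open>Independent pairs and Riemann sums of monotone functions\<close>

text \<open>
  The two variables may have values in different types, which is why this is not an instance of the
  corresponding fact about \<open>indep_var\<close>.
\<close>

lemma (in prob_space) distr_indep_pair:
  assumes "indep_pair S X T Y"
  shows "distr M (S \<Otimes>\<^sub>M T) (\<lambda>\<omega>. (X \<omega>, Y \<omega>)) = distr M S X \<Otimes>\<^sub>M distr M T Y"
proof -
  have [measurable]: "X \<in> measurable M S" "Y \<in> measurable M T"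
    using assms by (auto simp: indep_pair_def)
  interpret X: prob_space "distr M S X" by (rule prob_space_distr) simp
  interpret Y: prob_space "distr M T Y" by (rule prob_space_distr) simp
  show ?thesis
  proof (rule sym, rule pair_measure_eqI)
    fix A B assume "A \<in> sets (distr M S X)" "B \<in> sets (distr M T Y)"
    then have [measurable]: "A \<in> sets S" "B \<in> sets T" by auto
    have "prob ((X -` A \<inter> space M) \<inter> (Y -` B \<inter> space M))
        = prob (X -` A \<inter> space M) * prob (Y -` B \<inter> space M)"
      using assms unfolding indep_pair_def
      by (intro indep_setD) (auto intro!: in_vimage_algebra)
    moreover have "(\<lambda>\<omega>. (X \<omega>, Y \<omega>)) -` (A \<times> B) \<inter> space M
        = (X -` A \<inter> space M) \<inter> (Y -` B \<inter> space M)" by auto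
    ultimately show "emeasure (distr M S X) A * emeasure (distr M T Y) B
        = emeasure (distr M (S \<Otimes>\<^sub>M T) (\<lambda>\<omega>. (X \<omega>, Y \<omega>))) (A \<times> B)"
      by (simp add: emeasure_distr emeasure_eq_measure ennreal_mult)
  qed (auto intro: X.sigma_finite_measure_axioms Y.sigma_finite_measure_axioms)
qed

text \<open>
  Fubini's theorem in terms of two copies of the sample space: conditionally on \<open>X\<close>, the variable \<open>Y\<close>
  keeps its law.  All conditioning arguments below have this form.
\<close>

lemma (in prob_space) expectation_indep_pair:
  fixes f :: "'b \<Rightarrow> 'c \<Rightarrow> real"
  assumes ind: "indep_pair S X T Y"
    and f [measurable]: "(\<lambda>(x, y). f x y) \<in> borel_measurable (S \<Otimes>\<^sub>M T)"
    and bound: "\<And>x y. \<bar>f x y\<bar> \<le> B"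
  shows "expectation (\<lambda>\<omega>. f (X \<omega>) (Y \<omega>)) = expectation (\<lambda>\<omega>'. expectation (\<lambda>\<omega>. f (X \<omega>') (Y \<omega>)))"
proof -
  have [measurable]: "X \<in> measurable M S" "Y \<in> measurable M T"
    using ind by (auto simp: indep_pair_def)
  interpret X: prob_space "distr M S X" by (rule prob_space_distr) simp
  interpret Y: prob_space "distr M T Y" by (rule prob_space_distr) simp
  interpret XY: pair_prob_space "distr M S X" "distr M T Y" ..
  have int: "integrable (distr M S X \<Otimes>\<^sub>M distr M T Y) (\<lambda>(x, y). f x y)"
    by (rule XY.integrable_const_bound[where B = B]) (auto simp: bound split: prod.split)
  have "expectation (\<lambda>\<omega>. f (X \<omega>) (Y \<omega>))
      = (\<integral>z. (\<lambda>(x, y). f x y) z \<partial>distr M (S \<Otimes>\<^sub>M T) (\<lambda>\<omega>. (X \<omega>, Y \<omega>)))"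
    by (subst integral_distr) auto
  also have "\<dots> = (\<integral>x. (\<integral>y. f x y \<partial>distr M T Y) \<partial>distr M S X)"
    unfolding distr_indep_pair[OF ind] using XY.integral_fst'[OF int] by simp
  also have "\<dots> = expectation (\<lambda>\<omega>'. \<integral>y. f (X \<omega>') y \<partial>distr M T Y)"
    by (subst integral_distr) auto
  also have "\<dots> = expectation (\<lambda>\<omega>'. expectation (\<lambda>\<omega>. f (X \<omega>') (Y \<omega>)))"
  proof (rule Bochner_Integration.integral_cong[OF refl])
    fix \<omega>' assume "\<omega>' \<in> space M"
    then have [measurable]: "X \<omega>' \<in> space S" by (rule measurable_space[rotated]) simp
    have "(\<lambda>y. f (X \<omega>') y) = (\<lambda>(x, y). f x y) \<circ> Pair (X \<omega>')" by auto
    then have "(\<lambda>y. f (X \<omega>') y) \<in> borel_measurable T" by measurable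
    then show "(\<integral>y. f (X \<omega>') y \<partial>distr M T Y) = expectation (\<lambda>\<omega>. f (X \<omega>') (Y \<omega>))"
      by (subst integral_distr) auto
  qed
  finally show ?thesis .
qed

lemma set_integrable_mono_on:
  fixes f :: "real \<Rightarrow> real"
  assumes "mono_on {a..b} f"
  shows "set_integrable lborel {a..b} f"
proof -
  have "set_integrable lebesgue {a..b} f"
    using integrable_mono_on[OF assms] by (simp add: integrable_restrict_space set_integrable_def)
  moreover have "set_borel_measurable lborel {a..b} f"
    using borel_measurable_mono_on_fnc[OF assms]
    by (simp add: set_borel_measurable_def borel_measurable_restrict_space_iff)
  ultimately show ?thesis
    by (simp add: set_integrable_def set_borel_measurable_def integrable_completion)
qed

text \<open>
  Monotonicity bounds the integral over each interval of the partition by the values at its endpoints.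
\<close>

lemma mono_on_riemann_sum_bounds:
  fixes f :: "real \<Rightarrow> real" and d :: real and n :: nat
  assumes "mono_on {0..n * d} f" and d: "0 \<le> d"
  shows "d * (\<Sum>k<n. f (k * d)) \<le> integral {0..n * d} f"
    and "integral {0..n * d} f \<le> d * (\<Sum>k<n. f (Suc k * d))"
proof -
  have "d * (\<Sum>k<n. f (k * d)) \<le> integral {0..n * d} f \<and>
        integral {0..n * d} f \<le> d * (\<Sum>k<n. f (Suc k * d))"
    using assms(1)
  proof (induction n)
    case (Suc n)
    let ?a = "real n * d" and ?b = "real (Suc n) * d"
    have ab: "0 \<le> ?a" "?a \<le> ?b" "?b - ?a = d" using d by (auto simp: algebra_simps)
    have mon: "mono_on {0..?b} f" using Suc.prems .
    have m1: "mono_on {0..?a} f" and m2: "mono_on {?a..?b} f"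
      by (rule mono_on_subset[OF mon]; use ab in auto)+
    have int: "f integrable_on {0..?b}" "f integrable_on {?a..?b}"
      using integrable_on_mono_on mon m2 by auto
    have split: "integral {0..?b} f = integral {0..?a} f + integral {?a..?b} f"
      using Henstock_Kurzweil_Integration.integral_combine[OF ab(1,2) int(1)] by simp
    have "integral {?a..?b} (\<lambda>_. f ?a) \<le> integral {?a..?b} f"
      by (rule integral_le) (use int(2) m2 in \<open>auto simp: monotone_on_def\<close>)
    moreover have "integral {?a..?b} f \<le> integral {?a..?b} (\<lambda>_. f ?b)"
      by (rule integral_le) (use int(2) m2 in \<open>auto simp: monotone_on_def\<close>)
    ultimately show ?case
      using Suc.IH[OF m1] split ab by (simp add: algebra_simps)
  qed simp
  then show "d * (\<Sum>k<n. f (k * d)) \<le> integral {0..n * d} f"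
    and "integral {0..n * d} f \<le> d * (\<Sum>k<n. f (Suc k * d))" by blast+
qed

lemma LBINT_eq_integral_mono_on:
  fixes f :: "real \<Rightarrow> real"
  assumes "mono_on {a..b} f" "a \<le> b"
  shows "(LBINT s=a..b. f s) = integral {a..b} f"
  using interval_integral_eq_integral[OF assms(2) set_integrable_mono_on[OF assms(1)]] .

lemma riemann_sums_mono_on:
  fixes f :: "real \<Rightarrow> real"
  assumes mono: "mono_on {0..t} f" and t: "0 \<le> t"
  shows "(\<lambda>n. t / Suc n * (\<Sum>k<Suc n. f (k * (t / Suc n)))) \<longlonglongrightarrow> (LBINT s=0..t. f s)"
    and "(\<lambda>n. t / Suc n * (\<Sum>k<Suc n. f (Suc k * (t / Suc n)))) \<longlonglongrightarrow> (LBINT s=0..t. f s)"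
proof -
  define I where "I = (LBINT s=0..t. f s)"
  define l where "l = (\<lambda>n. t / Suc n * (\<Sum>k<Suc n. f (k * (t / Suc n))))"
  define r where "r = (\<lambda>n. t / Suc n * (\<Sum>k<Suc n. f (Suc k * (t / Suc n))))"
  have I: "I = integral {0..t} f"
    unfolding I_def using LBINT_eq_integral_mono_on[OF mono t] by (simp add: zero_ereal_def)
  have eq: "real (Suc n) * (t / Suc n) = t" for n by simp
  have l: "l n \<le> I" and r: "I \<le> r n" for n
    using mono_on_riemann_sum_bounds[of "Suc n" "t / Suc n" f, unfolded eq, OF mono] t
    unfolding l_def r_def I by (simp_all only: divide_nonneg_nonneg of_nat_0_le_iff)
  \<comment> \<open>The upper and the lower sum differ by a telescoping sum.\<close>
  have diff: "r n - l n = t * (f t - f 0) / Suc n" for n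
  proof -
    have "r n - l n = t / Suc n * (\<Sum>k<Suc n. f (Suc k * (t / Suc n)) - f (k * (t / Suc n)))"
      unfolding l_def r_def sum_subtractf right_diff_distrib by simp
    also have "(\<Sum>k<Suc n. f (Suc k * (t / Suc n)) - f (k * (t / Suc n))) = f t - f 0"
      by (subst sum_lessThan_telescope) (simp add: eq)
    finally show ?thesis by simp
  qed
  have "(\<lambda>n. t * (f t - f 0) / Suc n) \<longlonglongrightarrow> 0"
    using LIMSEQ_Suc[OF lim_const_over_n] by simp
  then have lim: "(\<lambda>n. r n - l n) \<longlonglongrightarrow> 0" unfolding diff .
  have "(\<lambda>n. I - (r n - l n)) \<longlonglongrightarrow> I - 0" "(\<lambda>n. I + (r n - l n)) \<longlonglongrightarrow> I + 0"
    by (intro tendsto_intros lim)+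
  then have lims: "(\<lambda>n. I - (r n - l n)) \<longlonglongrightarrow> I" "(\<lambda>n. I + (r n - l n)) \<longlonglongrightarrow> I" by simp_all
  have "l \<longlonglongrightarrow> I"
    by (rule tendsto_sandwich[OF _ _ lims(1) tendsto_const]) (use l r in \<open>auto simp: algebra_simps\<close>)
  then show "(\<lambda>n. t / Suc n * (\<Sum>k<Suc n. f (k * (t / Suc n)))) \<longlonglongrightarrow> (LBINT s=0..t. f s)"
    unfolding l_def I_def .
  have "r \<longlonglongrightarrow> I"
    by (rule tendsto_sandwich[OF _ _ tendsto_const lims(2)]) (use l r in \<open>auto simp: algebra_simps\<close>)
  then show "(\<lambda>n. t / Suc n * (\<Sum>k<Suc n. f (Suc k * (t / Suc n)))) \<longlonglongrightarrow> (LBINT s=0..t. f s)"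
    unfolding r_def I_def .
qed


section \<open>Probability generating functions\<close>

lemma integrable_pmf_power [simp]:
  fixes z :: real
  assumes "0 \<le> z" "z \<le> 1"
  shows "integrable (measure_pmf q) (\<lambda>n. z ^ n)"
  by (rule measure_pmf.integrable_const_bound[where B = 1]) (use assms in \<open>auto simp: power_le_one\<close>)

lemma gen_fun_nonneg: "0 \<le> z \<Longrightarrow> 0 \<le> gen_fun q z"
  unfolding gen_fun_def by (rule Bochner_Integration.integral_nonneg) auto

lemma gen_fun_mono: "0 \<le> y \<Longrightarrow> y \<le> z \<Longrightarrow> z \<le> 1 \<Longrightarrow> gen_fun q y \<le> gen_fun q z"
  unfolding gen_fun_def by (rule integral_mono) (auto intro: power_mono)

lemma gen_fun_1 [simp]: "gen_fun q 1 = 1"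
proof -
  have "(^) (1 :: real) = (\<lambda>_. 1)" by auto
  then show ?thesis unfolding gen_fun_def by simp
qed

lemma gen_fun_le_1: "0 \<le> z \<Longrightarrow> z \<le> 1 \<Longrightarrow> gen_fun q z \<le> 1"
  using gen_fun_mono[of z 1 q] by simp

lemma continuous_on_gen_fun: "continuous_on {0..1} (gen_fun q)"
  unfolding continuous_on_sequentially
proof (intro allI ballI impI)
  fix x :: "nat \<Rightarrow> real" and a
  assume "(\<forall>n. x n \<in> {0..1}) \<and> x \<longlonglongrightarrow> a"
  then show "(gen_fun q \<circ> x) \<longlonglongrightarrow> gen_fun q a"
    unfolding gen_fun_def comp_def
    by (intro integral_dominated_convergence[where w = "\<lambda>_. 1"] AE_I2 tendsto_power)
       (auto simp: power_le_one)
qed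

lemma gen_fun_poisson:
  assumes "0 < r" "0 \<le> x" "x \<le> 1"
  shows "gen_fun (poisson_pmf r) x = exp (r * (x - 1))"
proof -
  have "gen_fun (poisson_pmf r) x = (\<integral>k. pmf (poisson_pmf r) k * x ^ k \<partial>count_space UNIV)"
    unfolding gen_fun_def by (subst measure_pmf_eq_density, subst integral_density) auto
  also have "(\<lambda>k. pmf (poisson_pmf r) k * x ^ k) = (\<lambda>k. exp (- r) * ((r * x) ^ k / fact k))"
    using assms by (auto simp: power_mult_distrib)
  also have "(\<integral>k. exp (- r) * ((r * x) ^ k / fact k) \<partial>count_space UNIV)
      = (\<Sum>k. exp (- r) * ((r * x) ^ k / fact k))"
  proof (rule integral_count_space_nat)
    have "summable (\<lambda>k. exp (- r) * ((r * x) ^ k / fact k))"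
      using summable_exp[of "r * x"] by (intro summable_mult) (simp add: field_simps)
    then show "integrable (count_space UNIV) (\<lambda>k. exp (- r) * ((r * x) ^ k / fact k))"
      using assms by (simp add: integrable_count_space_nat_iff)
  qed
  also have "\<dots> = exp (- r) * exp (r * x)"
    using summable_exp[of "r * x"]
    by (subst suminf_mult) (simp_all add: exp_def field_simps scaleR_conv_of_real)
  finally show ?thesis by (simp add: mult_exp_exp algebra_simps)
qed

text \<open>
  Given the number of new vertices, the number of new edges is a sum of that many independent variables.
\<close>

lemma gen_fun_eps:
  assumes w: "0 \<le> w" "w \<le> 1"
  shows "gen_fun (eps_pmf \<kappa> p) w = gen_fun \<kappa> (gen_fun (phi_pmf p) w)"
proof -
  have x: "0 \<le> gen_fun (phi_pmf p) w" "gen_fun (phi_pmf p) w \<le> 1"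
    using w by (auto intro: gen_fun_nonneg gen_fun_le_1)
  have inner: "(\<integral>\<^sup>+\<phi>. ennreal (w ^ (\<Sum>j<k. \<phi> j)) \<partial>Pi_pmf {..<k} 0 (\<lambda>_. phi_pmf p))
      = ennreal (gen_fun (phi_pmf p) w ^ k)" for k
  proof -
    have "(\<integral>\<^sup>+\<phi>. ennreal (w ^ (\<Sum>j<k. \<phi> j)) \<partial>Pi_pmf {..<k} 0 (\<lambda>_. phi_pmf p))
        = (\<integral>\<^sup>+\<phi>. (\<Prod>j<k. ennreal (w ^ \<phi> j)) \<partial>Pi_pmf {..<k} 0 (\<lambda>_. phi_pmf p))"
      using w by (simp add: power_sum prod_ennreal)
    also have "\<dots> = (\<Prod>j<k. \<integral>\<^sup>+n. ennreal (w ^ n) \<partial>phi_pmf p)"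
      by (rule nn_integral_prod_Pi_pmf) simp
    also have "(\<integral>\<^sup>+n. ennreal (w ^ n) \<partial>phi_pmf p) = ennreal (gen_fun (phi_pmf p) w)"
      unfolding gen_fun_def by (rule nn_integral_eq_integral) (use w in auto)
    finally show ?thesis using x by (simp add: ennreal_power)
  qed
  have "ennreal (gen_fun (eps_pmf \<kappa> p) w) = (\<integral>\<^sup>+n. ennreal (w ^ n) \<partial>eps_pmf \<kappa> p)"
    unfolding gen_fun_def by (rule nn_integral_eq_integral[symmetric]) (use w in auto)
  also have "\<dots> = (\<integral>\<^sup>+k. ennreal (gen_fun (phi_pmf p) w ^ k) \<partial>\<kappa>)"
    unfolding eps_pmf_def by (simp add: inner)
  also have "\<dots> = ennreal (gen_fun \<kappa> (gen_fun (phi_pmf p) w))"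
    unfolding gen_fun_def[of \<kappa>] by (rule nn_integral_eq_integral) (use x in auto)
  finally show ?thesis
    using w x by (subst (asm) ennreal_inj) (auto intro: gen_fun_nonneg)
qed

text \<open>
  The increments of the edge count over the time intervals \<open>k < m\<close> are sums over consecutive blocks of
  birth events.  Attaching to the events of block \<open>k\<close> the weight \<open>a k\<close> turns a product over
  the intervals into one over single birth events.  The second identity, with \<open>\<gamma>\<close> the generating function
  of a single event, is stated together with the first one because both need the same weights.
\<close>

lemma prod_power_blocks:
  fixes a :: "nat \<Rightarrow> real" and n :: "nat \<Rightarrow> nat" and \<gamma> :: "real \<Rightarrow> real"
  assumes n: "mono n" "n 0 = 0" and a: "\<And>k. k < m \<Longrightarrow> a k \<in> {0..1}"
  shows "\<exists>v. (\<forall>i<n m. v i \<in> {0..1}) \<and>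
    (\<forall>x. (\<Prod>k<m. a k ^ (\<Sum>i\<in>{n k..<n (Suc k)}. x i)) = (\<Prod>i<n m. v i ^ x i)) \<and>
    (\<Prod>k<m. \<gamma> (a k) ^ (n (Suc k) - n k)) = (\<Prod>i<n m. \<gamma> (v i))"
  using a
proof (induction m)
  case 0
  then show ?case using n by simp
next
  case (Suc m)
  then obtain v where v: "\<forall>i<n m. v i \<in> {0..1}"
    "\<And>x. (\<Prod>k<m. a k ^ (\<Sum>i\<in>{n k..<n (Suc k)}. x i)) = (\<Prod>i<n m. v i ^ x i)"
    "(\<Prod>k<m. \<gamma> (a k) ^ (n (Suc k) - n k)) = (\<Prod>i<n m. \<gamma> (v i))"
    by fastforce
  have le: "n m \<le> n (Suc m)" using n(1) by (simp add: mono_def)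
  define v' where "v' i = (if i < n m then v i else a m)" for i
  have split: "(\<Prod>i<n (Suc m). h i) = (\<Prod>i<n m. h i) * (\<Prod>i=n m..<n (Suc m). h i)" for h :: "nat \<Rightarrow> real"
    using le by (simp add: prod.atLeastLessThan_concat lessThan_atLeast0)
  have "\<forall>i<n (Suc m). v' i \<in> {0..1}"
    using v(1) Suc.prems[of m] by (auto simp: v'_def)
  moreover have "(\<Prod>k<Suc m. a k ^ (\<Sum>i\<in>{n k..<n (Suc k)}. x i)) = (\<Prod>i<n (Suc m). v' i ^ x i)" for x
    unfolding split by (simp add: v(2) v'_def power_sum[symmetric])
  moreover have "(\<Prod>k<Suc m. \<gamma> (a k) ^ (n (Suc k) - n k)) = (\<Prod>i<n (Suc m). \<gamma> (v' i))"
    unfolding split by (simp add: v v'_def)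
  ultimately show ?case by blast
qed


section \<open>Increments of the edge count of a single edge\<close>

definition mark_edges :: "nat \<times> (nat \<Rightarrow> nat) \<Rightarrow> nat" where
  "mark_edges m = (\<Sum>j<fst m. snd m j)"

lemma measurable_sum_count_space [measurable (raw)]:
  fixes f :: "'i \<Rightarrow> 'a \<Rightarrow> nat"
  assumes "\<And>i. i \<in> I \<Longrightarrow> f i \<in> measurable M (count_space UNIV)"
  shows "(\<lambda>x. \<Sum>i\<in>I. f i x) \<in> measurable M (count_space UNIV)"
  using assms
proof (induction I rule: infinite_finite_induct)
  case (insert i I)
  then have [measurable]: "f i \<in> measurable M (count_space UNIV)"
    "(\<lambda>x. \<Sum>i\<in>I. f i x) \<in> measurable M (count_space UNIV)" by auto
  show ?case using insert by simp
qed auto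

lemma measurable_sum_interval [measurable (raw)]:
  fixes f :: "nat \<Rightarrow> 'a \<Rightarrow> nat"
  assumes [measurable]: "\<And>i. f i \<in> measurable M (count_space UNIV)"
    "m \<in> measurable M (count_space UNIV)" "n \<in> measurable M (count_space UNIV)"
  shows "(\<lambda>x. \<Sum>i=m x..<n x. f i x) \<in> measurable M (count_space UNIV)"
  by (rule measurable_compose_countable[where g = m], rule measurable_compose_countable[where g = n]) auto

lemma measurable_sum_lessThan [measurable (raw)]:
  fixes f :: "nat \<Rightarrow> 'a \<Rightarrow> nat"
  assumes [measurable]: "\<And>i. f i \<in> measurable M (count_space UNIV)"
    "n \<in> measurable M (count_space UNIV)"
  shows "(\<lambda>x. \<Sum>i<n x. f i x) \<in> measurable M (count_space UNIV)"
  by (rule measurable_compose_countable[where g = n]) auto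

lemma mark_edges_measurable [measurable]: "mark_edges \<in> measurable mark_space (count_space UNIV)"
  unfolding mark_edges_def by measurable

text \<open>
  Summation by parts.  It expresses the Riemann sum of the edge count by its increments.
\<close>

lemma abel_sum_increments:
  fixes x :: "nat \<Rightarrow> nat"
  assumes "mono x" "x 0 = 0"
  shows "(\<Sum>k<Suc N. (N - k) * (x (Suc k) - x k)) = (\<Sum>k<N. x (Suc k))"
proof (induction N)
  case (Suc N)
  have tel: "(\<Sum>k<m. x (Suc k) - x k) = x m" for m
    by (induction m) (use assms in \<open>auto simp: mono_iff_le_Suc\<close>)
  have "(\<Sum>k<Suc (Suc N). (Suc N - k) * (x (Suc k) - x k))
      = (\<Sum>k<Suc N. (Suc N - k) * (x (Suc k) - x k))" by simp
  also have "\<dots> = (\<Sum>k<Suc N. (N - k) * (x (Suc k) - x k) + (x (Suc k) - x k))"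
    by (intro sum.cong) (auto simp: Suc_diff_le)
  also have "\<dots> = (\<Sum>k<N. x (Suc k)) + x (Suc N)"
    using Suc tel[of "Suc N"] by (simp add: sum.distrib del: sum.lessThan_Suc)
  finally show ?case by simp
qed (use assms in simp)

locale edge_life_pos = edge_life +
  assumes b_pos: "0 < b" and c_pos: "0 < c"
begin

abbreviation "g \<equiv> gen_fun (eps_pmf \<kappa> p)"

text \<open>
  This number is defined for all ages, whether the edge is alive or not; the children of the edge are counted at the
  age \<open>L\<close>.
\<close>

definition edges_at :: "real \<Rightarrow> 'a \<Rightarrow> nat" where
  "edges_at t \<omega> = total_edges K \<phi> (\<pi> t \<omega>) \<omega>"

lemma mark_measurable [measurable]: "random_variable mark_space (mark K \<phi> i)"
  using marks_indep by (auto simp: indep_vars_def)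

lemma K_measurable [measurable]: "random_variable (count_space UNIV) (K i)"
  using K_\<phi>_indep by (auto simp: indep_pair_def)

lemma \<phi>_measurable [measurable]: "random_variable (count_space UNIV) (\<phi> i j)"
  using \<phi>_indep by (auto simp: indep_vars_def)

lemma \<pi>_measurable [measurable]: "0 \<le> t \<Longrightarrow> random_variable (count_space UNIV) (\<pi> t)"
  using poisson by (auto simp: unit_poisson_process_def)

declare L_measurable [measurable]

lemma new_edges_measurable [measurable]: "random_variable (count_space UNIV) (new_edges K \<phi> i)"
  unfolding new_edges_def by measurable

lemma edges_at_measurable [measurable]: "0 \<le> t \<Longrightarrow> random_variable (count_space UNIV) (edges_at t)"
  unfolding edges_at_def total_edges_def by measurable

lemma \<pi>_0: "\<omega> \<in> space M \<Longrightarrow> \<pi> 0 \<omega> = 0"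
  using poisson by (auto simp: unit_poisson_process_def)

lemma \<pi>_mono: "\<omega> \<in> space M \<Longrightarrow> 0 \<le> s \<Longrightarrow> s \<le> t \<Longrightarrow> \<pi> s \<omega> \<le> \<pi> t \<omega>"
  using poisson by (auto simp: unit_poisson_process_def monotone_on_def)

lemma \<pi>_right_continuous:
  assumes "\<omega> \<in> space M" "0 \<le> t"
  shows "\<exists>\<delta>>0. \<forall>s\<in>{t..<t + \<delta>}. \<pi> s \<omega> = \<pi> t \<omega>"
proof -
  have "((\<lambda>s. \<pi> s \<omega>) \<longlongrightarrow> \<pi> t \<omega>) (at_right t)"
    using poisson assms by (auto simp: unit_poisson_process_def continuous_within)
  then have "\<forall>\<^sub>F s in at_right t. \<pi> s \<omega> = \<pi> t \<omega>"
    by (auto simp: tendsto_discrete)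
  then obtain u where u: "u > t" "\<And>s. s > t \<Longrightarrow> s < u \<Longrightarrow> \<pi> s \<omega> = \<pi> t \<omega>"
    using eventually_at_right[of t "t + 1"] by auto
  show ?thesis
    by (rule exI[of _ "u - t"]) (use u in \<open>force simp: le_less\<close>)
qed

lemma edges_at_0: "\<omega> \<in> space M \<Longrightarrow> edges_at 0 \<omega> = 0"
  by (simp add: edges_at_def \<pi>_0 total_edges_def)

lemma edges_at_mono: "\<omega> \<in> space M \<Longrightarrow> 0 \<le> s \<Longrightarrow> s \<le> t \<Longrightarrow> edges_at s \<omega> \<le> edges_at t \<omega>"
  unfolding edges_at_def total_edges_def using \<pi>_mono by (intro sum_mono2) auto

lemma edges_at_increment:
  assumes "\<omega> \<in> space M" "0 \<le> s" "s \<le> t"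
  shows "edges_at t \<omega> - edges_at s \<omega> = (\<Sum>i=\<pi> s \<omega>..<\<pi> t \<omega>. new_edges K \<phi> i \<omega>)"
proof -
  have "(\<Sum>i<\<pi> t \<omega>. new_edges K \<phi> i \<omega>)
      = (\<Sum>i<\<pi> s \<omega>. new_edges K \<phi> i \<omega>) + (\<Sum>i=\<pi> s \<omega>..<\<pi> t \<omega>. new_edges K \<phi> i \<omega>)"
    using \<pi>_mono[OF assms] by (simp add: sum.atLeastLessThan_concat lessThan_atLeast0)
  then show ?thesis by (simp add: edges_at_def total_edges_def)
qed

lemma expectation_distr_pmf:
  fixes f :: "nat \<Rightarrow> real"
  assumes "distr M (count_space UNIV) X = measure_pmf q" and [measurable]: "random_variable (count_space UNIV) X"
  shows "expectation (\<lambda>\<omega>. f (X \<omega>)) = measure_pmf.expectation q f"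
  unfolding assms(1)[symmetric] by (subst integral_distr) auto

text \<open>
  Conditioning on \<open>K i\<close> reduces this to a product of independent factors.
\<close>

lemma new_edges_pgf:
  assumes w: "0 \<le> w" "w \<le> 1"
  shows "expectation (\<lambda>\<omega>. w ^ new_edges K \<phi> i \<omega>) = g w"
proof -
  let ?P = "gen_fun (phi_pmf p) w"
  have inner: "expectation (\<lambda>\<omega>. w ^ (\<Sum>j<k. \<phi> i j \<omega>)) = ?P ^ k" for k
  proof -
    have "indep_vars (\<lambda>_. borel) (\<lambda>j \<omega>. w ^ \<phi> i j \<omega>) {..<k}"
      by (rule indep_vars_compose2[OF indep_vars_subset[OF \<phi>_indep]]) auto
    then have "expectation (\<lambda>\<omega>. \<Prod>j<k. w ^ \<phi> i j \<omega>) = (\<Prod>j<k. expectation (\<lambda>\<omega>. w ^ \<phi> i j \<omega>))"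
      by (rule indep_vars_lebesgue_integral[rotated])
         (use w in \<open>auto intro!: integrable_const_bound[where B = 1] simp: power_le_one\<close>)
    moreover have "expectation (\<lambda>\<omega>. w ^ \<phi> i j \<omega>) = ?P" for j
      unfolding gen_fun_def by (rule expectation_distr_pmf[OF \<phi>_law]) simp
    ultimately show ?thesis by (simp add: power_sum)
  qed
  have "expectation (\<lambda>\<omega>. w ^ (\<Sum>j<K i \<omega>. \<phi> i j \<omega>))
      = expectation (\<lambda>\<omega>'. expectation (\<lambda>\<omega>. w ^ (\<Sum>j<K i \<omega>'. \<phi> i j \<omega>)))"
    by (rule expectation_indep_pair[OF K_\<phi>_indep, where f = "\<lambda>k y. w ^ (\<Sum>j<k. y j)" and B = 1])
       (use w in \<open>auto simp: power_le_one\<close>)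
  also have "\<dots> = expectation (\<lambda>\<omega>'. ?P ^ K i \<omega>')" by (simp only: inner)
  also have "\<dots> = gen_fun \<kappa> ?P"
    unfolding gen_fun_def[of \<kappa>] by (rule expectation_distr_pmf[OF K_law]) simp
  finally show ?thesis using w by (simp add: new_edges_def gen_fun_eps)
qed

lemma new_edges_eq: "new_edges K \<phi> i \<omega> = mark_edges (mark K \<phi> i \<omega>)"
  by (simp add: new_edges_def mark_edges_def mark_def)

lemma prod_new_edges_pgf:
  assumes "\<And>i. i < n \<Longrightarrow> v i \<in> {0..1::real}"
  shows "expectation (\<lambda>\<omega>. \<Prod>i<n. v i ^ new_edges K \<phi> i \<omega>) = (\<Prod>i<n. g (v i))"
proof -
  have "indep_vars (\<lambda>_. borel) (\<lambda>i \<omega>. v i ^ new_edges K \<phi> i \<omega>) {..<n}"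
    unfolding new_edges_eq
    by (rule indep_vars_compose2[OF indep_vars_subset[OF marks_indep]]) auto
  then have "expectation (\<lambda>\<omega>. \<Prod>i<n. v i ^ new_edges K \<phi> i \<omega>)
      = (\<Prod>i<n. expectation (\<lambda>\<omega>. v i ^ new_edges K \<phi> i \<omega>))"
    by (rule indep_vars_lebesgue_integral[rotated])
       (use assms in \<open>auto intro!: integrable_const_bound[where B = 1] simp: power_le_one\<close>)
  then show ?thesis using assms by (simp add: new_edges_pgf)
qed

text \<open>
  This says that the edge count is a compound Poisson process.  Given the path of the Poisson process, the marks are still
  independent, and each birth event in the \<open>k\<close>-th interval contributes the factor \<open>g (a k)\<close>; the numbers of these
  events are independent Poisson variables.
\<close>

lemma increments_pgf:
  fixes s :: "nat \<Rightarrow> real"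
  assumes s: "mono s" "s 0 = 0" and a: "\<And>k. k < m \<Longrightarrow> a k \<in> {0..1::real}"
  shows "expectation (\<lambda>\<omega>. \<Prod>k<m. a k ^ (edges_at (s (Suc k)) \<omega> - edges_at (s k) \<omega>))
       = (\<Prod>k<m. exp ((s (Suc k) - s k) * (g (a k) - 1)))"
proof -
  have s_nonneg [simp]: "0 \<le> s k" for k using monoD[OF s(1), of 0 k] s(2) by simp
  have s_le: "s k \<le> s (Suc k)" for k using monoD[OF s(1), of k "Suc k"] by simp
  have g01: "0 \<le> g (a k)" "g (a k) \<le> 1" if "k < m" for k
    using a[OF that] by (auto intro: gen_fun_nonneg gen_fun_le_1)
  have indep: "indep_vars (\<lambda>_. count_space UNIV) (\<lambda>k \<omega>. \<pi> (s (Suc k)) \<omega> - \<pi> (s k) \<omega>) {..<m}"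
    using poisson s by (simp add: unit_poisson_process_def)
  define F where "F x y = (\<Prod>k<m. a k ^ (\<Sum>i=x (s k)..<x (s (Suc k)). mark_edges (y i)))"
    for x :: "real \<Rightarrow> nat" and y
  have F: "\<bar>F x y\<bar> \<le> 1" for x y
    unfolding F_def abs_prod using a by (intro prod_le_1) (auto simp: power_le_one)
  have [measurable]: "(\<lambda>x. x (s k)) \<in> measurable path_space (count_space UNIV)" for k
    by (rule measurable_component_singleton) simp
  have F_meas: "(\<lambda>(x, y). F x y) \<in> borel_measurable (path_space \<Otimes>\<^sub>M PiM UNIV (\<lambda>_. mark_space))"
    unfolding F_def by measurable
  have F_eq: "F (path \<pi> \<omega>) (\<lambda>i. mark K \<phi> i \<omega>') = (\<Prod>k<m. a k ^ (\<Sum>i=\<pi> (s k) \<omega>..<\<pi> (s (Suc k)) \<omega>. new_edges K \<phi> i \<omega>'))"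
    for \<omega> \<omega>'
    unfolding F_def by (simp add: path_def new_edges_eq)
  have "expectation (\<lambda>\<omega>. \<Prod>k<m. a k ^ (edges_at (s (Suc k)) \<omega> - edges_at (s k) \<omega>))
      = expectation (\<lambda>\<omega>. F (path \<pi> \<omega>) (\<lambda>i. mark K \<phi> i \<omega>))"
    unfolding F_eq by (rule Bochner_Integration.integral_cong) (auto simp: edges_at_increment s_le)
  also have "\<dots> = expectation (\<lambda>\<omega>'. expectation (\<lambda>\<omega>. F (path \<pi> \<omega>') (\<lambda>i. mark K \<phi> i \<omega>)))"
    using expectation_indep_pair[OF path_marks_indep F_meas F] .
  also have "\<dots> = expectation (\<lambda>\<omega>'. \<Prod>k<m. g (a k) ^ (\<pi> (s (Suc k)) \<omega>' - \<pi> (s k) \<omega>'))"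
  proof (rule Bochner_Integration.integral_cong[OF refl])
    fix \<omega>' assume \<omega>': "\<omega>' \<in> space M"
    have "mono (\<lambda>k. \<pi> (s k) \<omega>')"
      using \<pi>_mono[OF \<omega>' s_nonneg s_le] by (simp add: mono_iff_le_Suc)
    from prod_power_blocks[OF this, of m a g] obtain v where v: "\<forall>i<\<pi> (s m) \<omega>'. v i \<in> {0..1}"
      "\<And>x. (\<Prod>k<m. a k ^ (\<Sum>i=\<pi> (s k) \<omega>'..<\<pi> (s (Suc k)) \<omega>'. x i)) = (\<Prod>i<\<pi> (s m) \<omega>'. v i ^ x i)"
      "(\<Prod>k<m. g (a k) ^ (\<pi> (s (Suc k)) \<omega>' - \<pi> (s k) \<omega>')) = (\<Prod>i<\<pi> (s m) \<omega>'. g (v i))"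
      using a \<pi>_0[OF \<omega>'] s(2) by auto
    show "expectation (\<lambda>\<omega>. F (path \<pi> \<omega>') (\<lambda>i. mark K \<phi> i \<omega>))
        = (\<Prod>k<m. g (a k) ^ (\<pi> (s (Suc k)) \<omega>' - \<pi> (s k) \<omega>'))"
      unfolding F_eq v(2,3) by (rule prod_new_edges_pgf) (use v(1) in auto)
  qed
  also have "\<dots> = (\<Prod>k<m. expectation (\<lambda>\<omega>'. g (a k) ^ (\<pi> (s (Suc k)) \<omega>' - \<pi> (s k) \<omega>')))"
  proof (rule indep_vars_lebesgue_integral)
    from indep show "indep_vars (\<lambda>_. borel) (\<lambda>k \<omega>. g (a k) ^ (\<pi> (s (Suc k)) \<omega> - \<pi> (s k) \<omega>)) {..<m}"
      by (rule indep_vars_compose2) auto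
  qed (use g01 in \<open>auto intro!: integrable_const_bound[where B = 1] simp: power_le_one\<close>)
  also have "\<dots> = (\<Prod>k<m. exp ((s (Suc k) - s k) * (g (a k) - 1)))"
  proof (rule prod.cong[OF refl])
    fix k assume "k \<in> {..<m}"
    then have k: "k < m" by simp
    show "expectation (\<lambda>\<omega>'. g (a k) ^ (\<pi> (s (Suc k)) \<omega>' - \<pi> (s k) \<omega>')) = exp ((s (Suc k) - s k) * (g (a k) - 1))"
    proof (cases "s k = s (Suc k)")
      case False
      then have "s k < s (Suc k)" using s_le[of k] by simp
      then have "distr M (count_space UNIV) (\<lambda>\<omega>. \<pi> (s (Suc k)) \<omega> - \<pi> (s k) \<omega>) = poisson_pmf (s (Suc k) - s k)"
        using poisson by (simp add: unit_poisson_process_def)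
      moreover have "random_variable (count_space UNIV) (\<lambda>\<omega>. \<pi> (s (Suc k)) \<omega> - \<pi> (s k) \<omega>)"
        using indep k by (simp add: indep_vars_def)
      ultimately have "expectation (\<lambda>\<omega>'. g (a k) ^ (\<pi> (s (Suc k)) \<omega>' - \<pi> (s k) \<omega>'))
          = gen_fun (poisson_pmf (s (Suc k) - s k)) (g (a k))"
        unfolding gen_fun_def[of "poisson_pmf (s (Suc k) - s k)"] by (rule expectation_distr_pmf)
      then show ?thesis
        using g01[OF k] \<open>s k < s (Suc k)\<close> by (simp add: gen_fun_poisson)
    qed (simp add: prob_space)
  qed
  finally show ?thesis .
qed

end


section \<open>The generating function of the edge count during life\<close>

text \<open>
  The expectation of \<open>z\<close> to the power of the edge count at age \<open>t\<close> on the event that the edge is then alive;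
  the lemma of the same name below proves this.
\<close>

definition survival_pgf :: "(real \<Rightarrow> real) \<Rightarrow> real \<Rightarrow> real \<Rightarrow> real \<Rightarrow> real \<Rightarrow> real" where
  "survival_pgf g b c z t = exp ((LBINT s=0..t. g (z * exp (- c * (t - s))) - 1) - b * t)"

context edge_life_pos
begin

lemma integral_edges_at_LIMSEQ:
  assumes "\<omega> \<in> space M" "0 \<le> t"
  shows "(\<lambda>n. t / Suc n * (\<Sum>k<Suc n. real (edges_at (Suc k * (t / Suc n)) \<omega>)))
           \<longlonglongrightarrow> (LBINT s=0..t. real (edges_at s \<omega>))"
  by (rule riemann_sums_mono_on) (use assms edges_at_mono in \<open>auto simp: monotone_on_def\<close>)

lemma integral_edges_at_measurable [measurable]:
  fixes t :: real
  assumes "0 \<le> t"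
  shows "(\<lambda>\<omega>. LBINT s=0..t. real (edges_at s \<omega>)) \<in> borel_measurable M"
proof (rule borel_measurable_LIMSEQ_real[OF integral_edges_at_LIMSEQ])
  fix n
  have [measurable]: "random_variable (count_space UNIV) (edges_at (real (Suc k) * (t / real (Suc n))))" for k
    using assms by (intro edges_at_measurable) simp
  show "(\<lambda>\<omega>. t / Suc n * (\<Sum>k<Suc n. real (edges_at (Suc k * (t / Suc n)) \<omega>))) \<in> borel_measurable M"
    by measurable
qed (use assms in auto)

text \<open>
  The additional time \<open>h\<close> is there because the change of \<open>z^B\<close> over a short interval is needed
  later, not only its value at a fixed age.
\<close>

lemma laplace_edges_at:
  assumes z: "0 \<le> z" "z \<le> 1" and t: "0 \<le> t" and h: "0 \<le> h"
  shows "expectation (\<lambda>\<omega>. exp (- c * (LBINT s=0..t. real (edges_at s \<omega>))) * z ^ edges_at (t + h) \<omega>)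
       = exp ((LBINT s=0..t. g (z * exp (- c * (t - s))) - 1) + h * (g z - 1))"
proof -
  define S where "S n \<omega> = t / Suc n * (\<Sum>k<Suc n. real (edges_at (Suc k * (t / Suc n)) \<omega>))" for n \<omega>
  have [measurable]: "random_variable (count_space UNIV) (edges_at (t + h))"
    using t h by simp
  have [measurable]: "S n \<in> borel_measurable M" for n
  proof -
    have [measurable]: "random_variable (count_space UNIV) (edges_at (real (Suc k) * (t / real (Suc n))))" for k
      using t by (intro edges_at_measurable) simp
    show ?thesis unfolding S_def by measurable
  qed
  have S_nonneg: "0 \<le> S n \<omega>" for n \<omega>
    unfolding S_def using t by (intro mult_nonneg_nonneg sum_nonneg) auto
  have S_lim: "(\<lambda>n. S n \<omega>) \<longlonglongrightarrow> (LBINT s=0..t. real (edges_at s \<omega>))" if "\<omega> \<in> space M" for \<omega>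
    using integral_edges_at_LIMSEQ[OF that t] unfolding S_def .
  define G where "G n = t / Suc n * (\<Sum>k<Suc n. g (z * exp (- c * (t - k * (t / Suc n)))) - 1)" for n
  have mono_G: "mono_on {0..t} (\<lambda>s. g (z * exp (- c * (t - s))) - 1)"
  proof (rule mono_onI)
    fix r s assume rs: "r \<in> {0..t}" "s \<in> {0..t}" "r \<le> s"
    have "exp (- c * (t - r)) \<le> exp (- c * (t - s))" "exp (- c * (t - s)) \<le> 1"
      using rs c_pos by auto
    then show "g (z * exp (- c * (t - r))) - 1 \<le> g (z * exp (- c * (t - s))) - 1"
      using z by (intro diff_right_mono gen_fun_mono mult_left_mono mult_le_one) auto
  qed
  have G_lim: "G \<longlonglongrightarrow> (LBINT s=0..t. g (z * exp (- c * (t - s))) - 1)"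
    unfolding G_def by (rule riemann_sums_mono_on(1)[OF mono_G t])
  have discrete: "expectation (\<lambda>\<omega>. exp (- c * S n \<omega>) * z ^ edges_at (t + h) \<omega>) = exp (G n + h * (g z - 1))" for n
  proof -
    \<comment> \<open>The first \<open>N\<close> intervals partition the time up to \<open>t\<close>, the last one is the additional time \<open>h\<close>.
      An edge born in interval \<open>k\<close> is counted in the last \<open>N - k\<close> terms of the Riemann sum, so it contributes
      \<open>a k\<close>.\<close>
    define N where "N = Suc n"
    define d where "d = t / N"
    define \<tau> where "\<tau> k = (if k \<le> N then k * d else t + h)" for k
    define a where "a k = z * exp (- c * (d * (N - k)))" for k
    have Nd: "N * d = t" and d: "0 \<le> d" using t by (auto simp: N_def d_def)
    have "k * d \<le> t + h" if "k \<le> N" for k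
      using that d h Nd mult_right_mono[of "real k" N d] by simp
    then have \<tau>: "mono \<tau>" "\<tau> 0 = 0"
      using d by (auto simp: mono_iff_le_Suc \<tau>_def algebra_simps)
    have \<tau>_nonneg: "0 \<le> \<tau> k" for k using monoD[OF \<tau>(1), of 0 k] \<tau>(2) by simp
    have a: "a k \<in> {0..1}" for k
      using z c_pos d by (auto simp: a_def intro!: mult_le_one)
    have "exp (- c * S n \<omega>) * z ^ edges_at (t + h) \<omega>
        = (\<Prod>k<Suc N. a k ^ (edges_at (\<tau> (Suc k)) \<omega> - edges_at (\<tau> k) \<omega>))"
      if \<omega>: "\<omega> \<in> space M" for \<omega>
    proof -
      let ?x = "\<lambda>k. edges_at (\<tau> k) \<omega>"
      have x: "mono ?x" "?x 0 = 0"
        using edges_at_mono[OF \<omega> \<tau>_nonneg] \<tau> edges_at_0[OF \<omega>] by (auto simp: mono_def)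
      have tel: "(\<Sum>k<m. ?x (Suc k) - ?x k) = ?x m" for m
        by (induction m) (use x in \<open>auto simp: mono_iff_le_Suc\<close>)
      have "(\<Prod>k<Suc N. a k ^ (?x (Suc k) - ?x k))
          = (\<Prod>k<Suc N. z ^ (?x (Suc k) - ?x k)) * (\<Prod>k<Suc N. exp (- c * d) ^ ((N - k) * (?x (Suc k) - ?x k)))"
        unfolding prod.distrib[symmetric]
        by (intro prod.cong refl)
           (auto simp: a_def power_mult_distrib power_mult exp_of_nat_mult[symmetric] mult_ac of_nat_diff)
      also have "\<dots> = z ^ ?x (Suc N) * exp (- c * d) ^ (\<Sum>k<N. ?x (Suc k))"
        unfolding power_sum[symmetric] tel abel_sum_increments[OF x] ..
      also have "exp (- c * d) ^ (\<Sum>k<N. ?x (Suc k)) = exp (- c * S n \<omega>)"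
        unfolding exp_of_nat_mult[symmetric]
        by (simp add: S_def \<tau>_def N_def[symmetric] d_def[symmetric] mult_ac del: of_nat_Suc)
      finally show ?thesis by (simp add: \<tau>_def)
    qed
    then have "expectation (\<lambda>\<omega>. exp (- c * S n \<omega>) * z ^ edges_at (t + h) \<omega>)
        = expectation (\<lambda>\<omega>. \<Prod>k<Suc N. a k ^ (edges_at (\<tau> (Suc k)) \<omega> - edges_at (\<tau> k) \<omega>))"
      by (rule Bochner_Integration.integral_cong[OF refl])
    also have "\<dots> = (\<Prod>k<Suc N. exp ((\<tau> (Suc k) - \<tau> k) * (g (a k) - 1)))"
      by (rule increments_pgf[OF \<tau> a])
    also have "\<dots> = exp (\<Sum>k<Suc N. (\<tau> (Suc k) - \<tau> k) * (g (a k) - 1))"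
      by (simp only: exp_sum finite_lessThan)
    also have "(\<Sum>k<Suc N. (\<tau> (Suc k) - \<tau> k) * (g (a k) - 1))
        = (\<Sum>k<N. d * (g (z * exp (- c * (t - k * d))) - 1)) + h * (g z - 1)"
    proof -
      have "(\<tau> (Suc k) - \<tau> k) * (g (a k) - 1) = d * (g (z * exp (- c * (t - k * d))) - 1)" if "k < N" for k
      proof -
        have "\<tau> (Suc k) - \<tau> k = d" using that by (simp add: \<tau>_def algebra_simps)
        moreover have "d * (N - k) = t - k * d"
          using Nd that by (simp add: algebra_simps of_nat_diff)
        ultimately show ?thesis by (simp add: a_def)
      qed
      then show ?thesis by (simp add: \<tau>_def Nd a_def)
    qed
    also have "(\<Sum>k<N. d * (g (z * exp (- c * (t - k * d))) - 1)) = G n"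
      unfolding G_def N_def d_def by (simp only: sum_distrib_left)
    finally show ?thesis .
  qed
  have "(\<lambda>n. expectation (\<lambda>\<omega>. exp (- c * S n \<omega>) * z ^ edges_at (t + h) \<omega>))
      \<longlonglongrightarrow> expectation (\<lambda>\<omega>. exp (- c * (LBINT s=0..t. real (edges_at s \<omega>))) * z ^ edges_at (t + h) \<omega>)"
  proof (rule integral_dominated_convergence[where w = "\<lambda>_. 1"])
    show "AE \<omega> in M. (\<lambda>n. exp (- c * S n \<omega>) * z ^ edges_at (t + h) \<omega>)
        \<longlonglongrightarrow> exp (- c * (LBINT s=0..t. real (edges_at s \<omega>))) * z ^ edges_at (t + h) \<omega>"
      by (intro AE_I2 tendsto_intros S_lim)
    show "AE \<omega> in M. norm (exp (- c * S n \<omega>) * z ^ edges_at (t + h) \<omega>) \<le> 1" for n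
      using z c_pos S_nonneg by (auto intro!: mult_le_one AE_I2 power_le_one simp: abs_mult)
  qed (use t in measurable)
  moreover have "(\<lambda>n. exp (G n + h * (g z - 1)))
      \<longlonglongrightarrow> exp ((LBINT s=0..t. g (z * exp (- c * (t - s))) - 1) + h * (g z - 1))"
    by (intro tendsto_intros G_lim)
  ultimately show ?thesis
    unfolding discrete by (rule LIMSEQ_unique)
qed

lemma history_measurable:
  "(\<lambda>\<omega>. (path \<pi> \<omega>, \<lambda>i. (K i \<omega>, new_edges K \<phi> i \<omega>)))
     \<in> measurable M (path_space \<Otimes>\<^sub>M PiM UNIV (\<lambda>_. count_space UNIV))"
proof -
  have [measurable]: "random_variable path_space (path \<pi>)"
    using path_marks_indep by (simp add: indep_pair_def)
  have "(\<lambda>\<omega>. (K i \<omega>, new_edges K \<phi> i \<omega>)) \<in> measurable M (count_space UNIV \<Otimes>\<^sub>M count_space UNIV)" for i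
    by measurable
  then have [measurable]: "(\<lambda>\<omega>. (K i \<omega>, new_edges K \<phi> i \<omega>)) \<in> measurable M (count_space UNIV)" for i
    by (simp add: pair_measure_countable)
  have "(\<lambda>\<omega> i. (K i \<omega>, new_edges K \<phi> i \<omega>)) \<in> measurable M (PiM UNIV (\<lambda>_. count_space UNIV))"
    by (rule measurable_PiM_single') auto
  then show ?thesis by measurable
qed

text \<open>
  The edge count depends on the marks only through the numbers of new edges, so it is known to the history.
\<close>

lemma edges_at_history_measurable:
  assumes "0 \<le> t"
  shows "edges_at t \<in> measurable (history M \<pi> K \<phi>) (count_space UNIV)"
proof -
  let ?N = "path_space \<Otimes>\<^sub>M PiM (UNIV :: nat set) (\<lambda>_. count_space (UNIV :: (nat \<times> nat) set))"
  have [measurable]: "(\<lambda>z. fst z t) \<in> measurable ?N (count_space UNIV)"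
    by (rule measurable_compose[OF measurable_fst measurable_component_singleton]) (use assms in simp)
  have [measurable]: "(\<lambda>z. snd (snd z i)) \<in> measurable ?N (count_space UNIV)" for i
    by (rule measurable_compose[OF measurable_compose[OF measurable_snd measurable_component_singleton]]) auto
  have "(\<lambda>z. \<Sum>i<fst z t. snd (snd z i)) \<in> measurable ?N (count_space UNIV)"
    by measurable
  then have "(\<lambda>z. \<Sum>i<fst z t. snd (snd z i)) \<circ> (\<lambda>\<omega>. (path \<pi> \<omega>, \<lambda>i. (K i \<omega>, new_edges K \<phi> i \<omega>)))
      \<in> measurable (history M \<pi> K \<phi>) (count_space UNIV)"
    unfolding history_def
    by (intro measurable_comp[OF measurable_vimage_algebra1])
       (use measurable_space[OF history_measurable] in blast)+
  then show ?thesis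
    using assms by (simp add: comp_def edges_at_def[abs_def] total_edges_def path_def)
qed

lemma set_integrable_edges_at:
  assumes "\<omega> \<in> space M" "0 \<le> t"
  shows "interval_lebesgue_integrable lborel 0 (ereal t) (\<lambda>s. real (edges_at s \<omega>))"
proof -
  have "set_integrable lborel {0..t} (\<lambda>s. real (edges_at s \<omega>))"
    by (rule set_integrable_mono_on) (use assms edges_at_mono in \<open>auto simp: monotone_on_def\<close>)
  then have "set_integrable lborel (einterval 0 (ereal t)) (\<lambda>s. real (edges_at s \<omega>))"
    by (rule set_integrable_subset) (auto simp: einterval_def zero_ereal_def)
  then show ?thesis using assms(2) by (simp add: interval_lebesgue_integrable_def)
qed

text \<open>
  Conditioning on the history, which determines the edge count, replaces the event of being alive at age \<open>t\<close> by its
  conditional probability.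
\<close>

lemma survival_pgf:
  assumes z: "0 \<le> z" "z \<le> 1" and t: "0 \<le> t" and h: "0 \<le> h"
  shows "expectation (\<lambda>\<omega>. z ^ edges_at (t + h) \<omega> * indicator {\<omega> \<in> space M. t < L \<omega>} \<omega>)
       = survival_pgf g b c z t * exp (h * (g z - 1))"
proof -
  let ?H = "history M \<pi> K \<phi>" and ?f = "\<lambda>\<omega>. z ^ edges_at (t + h) \<omega>"
  let ?i = "indicator {\<omega> \<in> space M. t < L \<omega>} :: 'a \<Rightarrow> real"
  have sub: "subalgebra M ?H"
    unfolding subalgebra_def history_def
    by (auto intro: sets_image_in_sets[OF _ history_measurable, THEN subsetD])
  interpret H: finite_measure_subalgebra M ?H by unfold_locales (rule sub)
  have [measurable]: "random_variable (count_space UNIV) (edges_at (t + h))" using t h by simp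
  have f: "?f \<in> borel_measurable ?H"
    by (rule measurable_compose[OF edges_at_history_measurable]) (use t h in simp_all)
  have [measurable]: "?f \<in> borel_measurable M" by (rule measurable_from_subalg[OF sub f])
  have int: "integrable M (\<lambda>\<omega>. ?f \<omega> * ?i \<omega>)"
    by (rule integrable_const_bound[where B = 1]) (use z in \<open>auto simp: power_le_one indicator_def\<close>)
  have "expectation (\<lambda>\<omega>. ?f \<omega> * ?i \<omega>) = expectation (\<lambda>\<omega>. ?f \<omega> * real_cond_exp M ?H ?i \<omega>)"
    by (rule H.real_cond_exp_intg(2)[symmetric, OF int f]) simp
  also have "\<dots> = expectation (\<lambda>\<omega>. exp (- b * t) * (exp (- c * (LBINT s=0..t. real (edges_at s \<omega>))) * ?f \<omega>))"
  proof (rule integral_cong_AE)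
    show "AE \<omega> in M. ?f \<omega> * real_cond_exp M ?H ?i \<omega>
        = exp (- b * t) * (exp (- c * (LBINT s=0..t. real (edges_at s \<omega>))) * ?f \<omega>)"
      using L_law[OF t] AE_space
    proof eventually_elim
      case (elim \<omega>)
      have "(LBINT s=0..t. b + c * real (edges_at s \<omega>)) = b * t + c * (LBINT s=0..t. real (edges_at s \<omega>))"
        using set_integrable_edges_at[OF elim(2) t] t
        by (subst interval_lebesgue_integral_add) (auto simp: zero_ereal_def)
      then show ?case
        using elim(1) by (simp add: edges_at_def mult_exp_exp)
    qed
    show "(\<lambda>\<omega>. ?f \<omega> * real_cond_exp M ?H ?i \<omega>) \<in> borel_measurable M"
      by (intro borel_measurable_times measurable_from_subalg[OF sub f] borel_measurable_cond_exp2)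
  qed (use t in measurable)
  also have "\<dots> = exp (- b * t) * exp ((LBINT s=0..t. g (z * exp (- c * (t - s))) - 1) + h * (g z - 1))"
    using laplace_edges_at[OF assms] by simp
  finally show ?thesis
    by (simp add: survival_pgf_def mult_exp_exp algebra_simps)
qed

end


section \<open>The generating function of the offspring\<close>

lemma riemann_sums_antimono_on:
  fixes f :: "real \<Rightarrow> real"
  assumes anti: "antimono_on {0..t} f" and t: "0 \<le> t"
  shows "(\<lambda>n. t / Suc n * (\<Sum>k<Suc n. f (k * (t / Suc n)))) \<longlonglongrightarrow> (LBINT s=0..t. f s)"
proof -
  have "mono_on {0..t} (\<lambda>s. - f s)" using anti by (auto simp: monotone_on_def)
  from tendsto_minus[OF riemann_sums_mono_on(1)[OF this t]] show ?thesis
    by (simp only: sum_negf interval_lebesgue_integral_uminus mult_minus_right minus_minus)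
qed

text \<open>
  The difference quotient of the exponential function along the mesh sizes of the partitions.
\<close>

lemma tendsto_one_minus_exp:
  assumes "0 < T"
  shows "(\<lambda>n. (1 - exp (T / Suc n * - \<gamma>)) / (T / Suc n)) \<longlonglongrightarrow> (\<gamma> :: real)"
proof -
  have "((\<lambda>x. exp (x * - \<gamma>)) has_real_derivative (- \<gamma>)) (at 0)"
    by (auto intro!: derivative_eq_intros)
  then have "((\<lambda>x. - ((exp (x * - \<gamma>) - 1) / x)) \<longlongrightarrow> - (- \<gamma>)) (at 0)"
    unfolding has_field_derivative_iff by (intro tendsto_minus) simp
  moreover have "filterlim (\<lambda>n. T / Suc n) (at 0) sequentially"
    using LIMSEQ_Suc[OF lim_const_over_n, of T] assms by (auto simp: filterlim_at)
  ultimately have "(\<lambda>n. - ((exp (T / Suc n * - \<gamma>) - 1) / (T / Suc n))) \<longlonglongrightarrow> - (- \<gamma>)"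
    by (rule filterlim_compose)
  then show ?thesis by (simp only: minus_divide_left minus_diff_eq minus_minus)
qed

text \<open>
  Monotone in \<open>t\<close> because both the power and the event of being alive decrease.  This is what makes the
  Riemann sums in the next theorem converge.
\<close>

lemma (in edge_life_pos) survival_pgf_antimono:
  assumes z: "0 \<le> z" "z \<le> 1" and t: "0 \<le> s" "s \<le> t"
  shows "survival_pgf g b c z t \<le> survival_pgf g b c z s"
proof -
  have eq: "survival_pgf g b c z u = expectation (\<lambda>\<omega>. z ^ edges_at u \<omega> * indicator {\<omega> \<in> space M. u < L \<omega>} \<omega>)"
    if "0 \<le> u" for u
    using survival_pgf[OF z that, of 0] by simp
  have int: "integrable M (\<lambda>\<omega>. z ^ edges_at u \<omega> * indicator {\<omega> \<in> space M. u < L \<omega>} \<omega>)" if "0 \<le> u" for u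
    by (rule integrable_const_bound[where B = 1])
       (use z that in \<open>auto simp: power_le_one indicator_def\<close>)
  show ?thesis
    unfolding eq[OF t(1)] eq[OF order_trans[OF t]]
  proof (rule integral_mono[OF int int])
    fix \<omega> assume "\<omega> \<in> space M"
    then show "z ^ edges_at t \<omega> * indicator {\<omega> \<in> space M. t < L \<omega>} \<omega>
             \<le> z ^ edges_at s \<omega> * indicator {\<omega> \<in> space M. s < L \<omega>} \<omega>"
      using z t edges_at_mono[of \<omega> s t] by (auto simp: indicator_def intro: power_decreasing)
  qed (use t in auto)
qed

text \<open>
  The life of the edge is cut into intervals of length \<open>d = T / (n + 1)\<close>, and the edge count at death is replaced by
  the one at the end of the interval in which the edge dies.  The right-continuity of the Poisson process
  makes this harmless in the limit.  Every summand of the approximation is a difference of two expectations of the kind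
  computed in \<open>survival_pgf\<close>, and the sum becomes a telescoping sum plus a Riemann sum.
\<close>

theorem (in edge_life_pos) offspring_pgf:
  assumes z: "0 \<le> z" "z \<le> 1" and T: "0 < T"
  shows "(\<lambda>\<omega>. z ^ edges_at (L \<omega>) \<omega> * indicator {\<omega> \<in> space M. L \<omega> \<le> T} \<omega>) \<in> borel_measurable M"
    and "expectation (\<lambda>\<omega>. z ^ edges_at (L \<omega>) \<omega> * indicator {\<omega> \<in> space M. L \<omega> \<le> T} \<omega>)
       = 1 - survival_pgf g b c z T - (1 - g z) * (LBINT t=0..T. survival_pgf g b c z t)"
proof -
  define f where "f = survival_pgf g b c z"
  define d where "d n = T / Suc n" for n
  define I where "I t = (indicator {\<omega> \<in> space M. t < L \<omega>} :: 'a \<Rightarrow> real)" for t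
  define Y where "Y \<omega> = z ^ edges_at (L \<omega>) \<omega> * indicator {\<omega> \<in> space M. L \<omega> \<le> T} \<omega>" for \<omega>
  define X where "X n \<omega> = (\<Sum>k<Suc n. z ^ edges_at (Suc k * d n) \<omega> * (I (k * d n) \<omega> - I (Suc k * d n) \<omega>))" for n \<omega>
  have d: "0 < d n" "Suc n * d n = T" for n using T by (auto simp: d_def)
  have [measurable]: "random_variable (count_space UNIV) (edges_at (Suc k * d n))" for k n
    by (rule edges_at_measurable) (use d(1)[of n] in simp)
  have [measurable]: "I t \<in> borel_measurable M" for t unfolding I_def by measurable
  have X_meas [measurable]: "X n \<in> borel_measurable M" for n unfolding X_def by measurable
  have X_zero: "X n \<omega> = 0" if "\<omega> \<in> space M" "T < L \<omega>" for n \<omega>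
  proof -
    have "k * d n < L \<omega>" if "k \<le> Suc n" for k
    proof -
      have "real k * d n \<le> Suc n * d n" using that d(1)[of n] by (intro mult_right_mono) auto
      then show ?thesis using d(2) \<open>T < L \<omega>\<close> by simp
    qed
    then have "I (k * d n) \<omega> - I (Suc k * d n) \<omega> = 0" if "k < Suc n" for k
      using that \<open>\<omega> \<in> space M\<close> by (simp add: I_def indicator_def del: of_nat_Suc)
    then show ?thesis unfolding X_def by simp
  qed
  have X_eq: "\<exists>r\<in>{L \<omega>..<L \<omega> + d n}. X n \<omega> = z ^ edges_at r \<omega>" if \<omega>: "\<omega> \<in> space M" "L \<omega> \<le> T" for n \<omega>
  proof -
    \<comment> \<open>The edge dies in interval \<open>m\<close>, which is open on the left and closed on the right.\<close>
    define m where "m = nat (\<lceil>L \<omega> / d n\<rceil> - 1)"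
    have pos: "0 < L \<omega> / d n" using L_pos[OF \<omega>(1)] d(1) by simp
    then have m: "real m < L \<omega> / d n" "L \<omega> / d n \<le> Suc m"
      unfolding m_def by linarith+
    have bounds: "m * d n < L \<omega>" "L \<omega> \<le> Suc m * d n"
      using m d(1)[of n] by (simp_all add: field_simps)
    have "real m < real (Suc n)"
      using bounds(1) \<omega>(2) d(1)[of n] d(2)[of n, symmetric]
      by (metis mult_less_cancel_right_pos order_less_le_trans)
    then have mn: "m < Suc n" by simp
    have zero: "I (k * d n) \<omega> - I (Suc k * d n) \<omega> = 0" if "k \<noteq> m" for k
    proof (cases "k < m")
      case True
      then have "real (Suc k) * d n \<le> m * d n"
        using d(1)[of n] by (intro mult_right_mono) auto
      moreover have "real k * d n \<le> m * d n"
        using True d(1)[of n] by (intro mult_right_mono) auto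
      ultimately show ?thesis using bounds \<omega>(1) by (simp add: I_def indicator_def del: of_nat_Suc)
    next
      case False
      with that have "real (Suc m) * d n \<le> k * d n"
        using d(1)[of n] by (intro mult_right_mono) auto
      moreover have "real k * d n \<le> Suc k * d n"
        using d(1)[of n] by (intro mult_right_mono) auto
      ultimately show ?thesis using bounds \<omega>(1) by (simp add: I_def indicator_def del: of_nat_Suc)
    qed
    have "X n \<omega> = (\<Sum>k<Suc n. if k = m then z ^ edges_at (Suc m * d n) \<omega> else 0)"
      unfolding X_def
    proof (rule sum.cong[OF refl])
      fix k assume "k \<in> {..<Suc n}"
      show "z ^ edges_at (Suc k * d n) \<omega> * (I (k * d n) \<omega> - I (Suc k * d n) \<omega>)
          = (if k = m then z ^ edges_at (Suc m * d n) \<omega> else 0)"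
      proof (cases "k = m")
        case True
        then show ?thesis using bounds \<omega>(1) by (simp add: I_def indicator_def del: of_nat_Suc)
      next
        case False
        then show ?thesis using zero[OF False] by (simp del: of_nat_Suc)
      qed
    qed
    also have "\<dots> = z ^ edges_at (Suc m * d n) \<omega>"
      by (subst sum.delta) (use mn in \<open>auto simp del: sum.lessThan_Suc\<close>)
    finally show ?thesis
      using bounds by (intro bexI[of _ "Suc m * d n"]) (auto simp: algebra_simps)
  qed
  have X_bound: "norm (X n \<omega>) \<le> 1" if "\<omega> \<in> space M" for n \<omega>
  proof (cases "L \<omega> \<le> T")
    case True
    from X_eq[OF that this, of n] obtain r where "X n \<omega> = z ^ edges_at r \<omega>" by auto
    then show ?thesis using z by (simp add: power_le_one)
  qed (use X_zero[OF that] in auto)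
  have d_lim: "d \<longlonglongrightarrow> 0"
    unfolding d_def using LIMSEQ_Suc[OF lim_const_over_n] by simp
  have X_lim: "(\<lambda>n. X n \<omega>) \<longlonglongrightarrow> Y \<omega>" if \<omega>: "\<omega> \<in> space M" for \<omega>
  proof (cases "L \<omega> \<le> T")
    case True
    obtain \<delta> where \<delta>: "\<delta> > 0" "\<And>r. r \<in> {L \<omega>..<L \<omega> + \<delta>} \<Longrightarrow> \<pi> r \<omega> = \<pi> (L \<omega>) \<omega>"
      using \<pi>_right_continuous[OF \<omega> less_imp_le[OF L_pos[OF \<omega>]]] by blast
    have "\<forall>\<^sub>F n in sequentially. d n < \<delta>"
      using order_tendstoD(2)[OF d_lim \<delta>(1)] .
    then have "\<forall>\<^sub>F n in sequentially. X n \<omega> = Y \<omega>"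
    proof eventually_elim
      case (elim n)
      obtain r where "r \<in> {L \<omega>..<L \<omega> + d n}" "X n \<omega> = z ^ edges_at r \<omega>"
        using X_eq[OF \<omega> True, of n] by auto
      with elim \<delta>(2)[of r] show ?case
        using True \<omega> by (simp add: Y_def edges_at_def)
    qed
    then show ?thesis by (rule tendsto_eventually)
  qed (use X_zero[OF \<omega>] in \<open>simp add: Y_def\<close>)
  have Y_meas: "Y \<in> borel_measurable M"
    by (rule borel_measurable_LIMSEQ_real[OF X_lim X_meas])
  then show "(\<lambda>\<omega>. z ^ edges_at (L \<omega>) \<omega> * indicator {\<omega> \<in> space M. L \<omega> \<le> T} \<omega>) \<in> borel_measurable M"
    unfolding Y_def[abs_def] .
  have lim1: "(\<lambda>n. expectation (X n)) \<longlonglongrightarrow> expectation Y"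
    by (rule integral_dominated_convergence[where w = "\<lambda>_. 1", OF Y_meas X_meas])
       (simp_all add: AE_I2 X_lim X_bound del: real_norm_def)
  have EX: "expectation (X n) = f 0 - f T - (1 - exp (d n * - (1 - g z))) / d n * (d n * (\<Sum>k<Suc n. f (k * d n)))" for n
  proof -
    have E1: "expectation (\<lambda>\<omega>. z ^ edges_at (Suc k * d n) \<omega> * I (k * d n) \<omega>) = f (k * d n) * exp (d n * (g z - 1))" for k
      unfolding I_def f_def
      using survival_pgf[OF z, of "k * d n" "d n"] d(1)[of n] by (simp add: algebra_simps)
    have E2: "expectation (\<lambda>\<omega>. z ^ edges_at (Suc k * d n) \<omega> * I (Suc k * d n) \<omega>) = f (Suc k * d n)" for k
      unfolding I_def f_def
      using survival_pgf[OF z, of "Suc k * d n" 0] d(1)[of n] by simp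
    have int: "integrable M (\<lambda>\<omega>. z ^ edges_at (Suc k * d n) \<omega> * I t \<omega>)" for k t
    proof (rule integrable_const_bound[where B = 1])
      show "(\<lambda>\<omega>. z ^ edges_at (Suc k * d n) \<omega> * I t \<omega>) \<in> borel_measurable M" by measurable
    qed (use z in \<open>auto simp: power_le_one I_def indicator_def\<close>)
    have "expectation (X n) = (\<Sum>k<Suc n. f (k * d n) * exp (d n * (g z - 1)) - f (Suc k * d n))"
      unfolding X_def right_diff_distrib[of "z ^ k" for k]
      by (subst Bochner_Integration.integral_sum)
         (use int in \<open>auto simp only: Bochner_Integration.integral_diff E1 E2 intro: Bochner_Integration.integrable_diff\<close>)
    also have "\<dots> = (\<Sum>k<Suc n. (f (k * d n) - f (Suc k * d n)) - (1 - exp (d n * (g z - 1))) * f (k * d n))"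
      by (intro sum.cong) (auto simp: algebra_simps)
    also have "\<dots> = (\<Sum>k<Suc n. f (k * d n) - f (Suc k * d n)) - (1 - exp (d n * (g z - 1))) * (\<Sum>k<Suc n. f (k * d n))"
      unfolding sum_subtractf sum_distrib_left ..
    also have "(\<Sum>k<Suc n. f (k * d n) - f (Suc k * d n)) = f 0 - f T"
      by (subst sum_lessThan_telescope') (simp only: d of_nat_0 mult_zero_left)
    finally show ?thesis using d(1)[of n] by simp
  qed
  have "antimono_on {0..T} f"
    unfolding f_def using survival_pgf_antimono[OF z] by (auto simp: monotone_on_def)
  from riemann_sums_antimono_on[OF this] T
  have "(\<lambda>n. d n * (\<Sum>k<Suc n. f (k * d n))) \<longlonglongrightarrow> (LBINT t=0..T. f t)"
    unfolding d_def by simp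
  then have lim2: "(\<lambda>n. expectation (X n)) \<longlonglongrightarrow> f 0 - f T - (1 - g z) * (LBINT t=0..T. f t)"
    unfolding EX by (intro tendsto_intros tendsto_one_minus_exp[OF T, folded d_def])
  have "f 0 = 1" by (simp add: f_def survival_pgf_def zero_ereal_def)
  with LIMSEQ_unique[OF lim1 lim2]
  show "expectation (\<lambda>\<omega>. z ^ edges_at (L \<omega>) \<omega> * indicator {\<omega> \<in> space M. L \<omega> \<le> T} \<omega>)
       = 1 - survival_pgf g b c z T - (1 - g z) * (LBINT t=0..T. survival_pgf g b c z t)"
    by (simp add: Y_def[abs_def] f_def)
qed


section \<open>The recursion over generations\<close>

type_synonym life = "(real \<Rightarrow> nat) \<times> (nat \<Rightarrow> nat \<times> (nat \<Rightarrow> nat)) \<times> real"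

abbreviation life_space :: "life measure" where
  "life_space \<equiv> path_space \<Otimes>\<^sub>M (PiM UNIV (\<lambda>_. mark_space) \<Otimes>\<^sub>M borel)"

text \<open>
  Whether the life \<open>l\<close> of an edge gives it the child with label \<open>y = (i, j, r)\<close>.  The first conjunct says that
  event \<open>i\<close> happens up to the death of the edge.  It evaluates the path at rational times
  only, because evaluating it at the random time of death is not a measurable operation on the
  space of all paths; for right-continuous paths there is no difference.
\<close>

definition child :: "(nat \<times> nat \<Rightarrow> bool) \<Rightarrow> life \<Rightarrow> nat \<times> nat \<times> bool \<Rightarrow> bool" where
  "child \<sigma> l y \<longleftrightarrow>
     (\<forall>a b. snd (snd l) < real a / real (Suc b) \<longrightarrow> fst y < fst l (real a / real (Suc b))) \<and>
     fst (snd y) < fst (fst (snd l) (fst y)) \<and>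
     (snd (fst (snd l) (fst y)) (fst (snd y)) = 2 \<or> \<sigma> (fst y, fst (snd y)) = snd (snd y))"

text \<open>
  In the progeny of \<open>e\<close>, with \<open>e\<close> as generation 0, all edges of the generations below \<open>n\<close> live at
  most \<open>T\<close>, and the \<open>n\<close>-th generation is empty if \<open>x\<close> is false.  The argument \<open>\<Lambda>\<close> gives the lives of all potential edges and
  \<open>\<sigma>\<close> the endpoints chosen by the semi-cherries.
\<close>

primrec short_lived ::
  "bool \<Rightarrow> real \<Rightarrow> nat \<Rightarrow> (edge \<Rightarrow> life) \<Rightarrow> (edge \<times> nat \<times> nat \<Rightarrow> bool) \<Rightarrow> edge \<Rightarrow> bool" where
  "short_lived x T 0 \<Lambda> \<sigma> e \<longleftrightarrow> x"
| "short_lived x T (Suc n) \<Lambda> \<sigma> e \<longleftrightarrow> snd (snd (\<Lambda> e)) \<le> T \<and>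
     (\<forall>y. child (\<lambda>ij. \<sigma> (e, ij)) (\<Lambda> e) y \<longrightarrow> short_lived x T n \<Lambda> \<sigma> (y # e))"

abbreviation descendants :: "edge \<Rightarrow> edge set" where
  "descendants e \<equiv> range (\<lambda>ys. ys @ e)"

lemma descendants_Cons_subset: "descendants (y # e) \<subseteq> descendants e"
proof
  fix e' assume "e' \<in> descendants (y # e)"
  then obtain ys where "e' = (ys @ [y]) @ e" by auto
  then show "e' \<in> descendants e" by (rule image_eqI) simp
qed

lemma short_lived_cong:
  assumes "\<And>e'. e' \<in> descendants e \<Longrightarrow> \<Lambda> e' = \<Lambda>' e'"
  shows "short_lived x T n \<Lambda> \<sigma> e \<longleftrightarrow> short_lived x T n \<Lambda>' \<sigma> e"
  using assms
proof (induction n arbitrary: e)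
  case (Suc n)
  have "\<Lambda> e = \<Lambda>' e" by (rule Suc.prems) (auto intro: range_eqI[of _ _ "[]"])
  moreover have "short_lived x T n \<Lambda> \<sigma> (y # e) \<longleftrightarrow> short_lived x T n \<Lambda>' \<sigma> (y # e)" for y
    using descendants_Cons_subset by (intro Suc.IH Suc.prems) auto
  ultimately show ?case by simp
qed simp

lemma child_measurable:
  assumes l: "l \<in> measurable N life_space"
    and \<sigma>: "\<And>ij. (\<lambda>w. \<sigma> w ij) \<in> measurable N (count_space UNIV)"
  shows "(\<lambda>w. child (\<sigma> w) (l w) y) \<in> measurable N (count_space UNIV)"
proof -
  note \<sigma> [measurable]
  have [measurable]: "(\<lambda>w. fst (l w) t) \<in> measurable N (count_space UNIV)" if "0 \<le> t" for t
    by (rule measurable_compose[OF measurable_compose[OF l measurable_fst] measurable_component_singleton])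
       (use that in simp)
  have m: "(\<lambda>w. fst (snd (l w)) i) \<in> measurable N mark_space" for i
    by (rule measurable_compose[OF measurable_compose[OF measurable_compose[OF l measurable_snd] measurable_fst]
          measurable_component_singleton]) simp
  have [measurable]: "(\<lambda>w. fst (fst (snd (l w)) i)) \<in> measurable N (count_space UNIV)" for i
    by (rule measurable_compose[OF m measurable_fst])
  have [measurable]: "(\<lambda>w. snd (fst (snd (l w)) i) j) \<in> measurable N (count_space UNIV)" for i j
    by (rule measurable_compose[OF measurable_compose[OF m measurable_snd] measurable_component_singleton]) simp
  have [measurable]: "(\<lambda>w. snd (snd (l w))) \<in> measurable N borel"
    by (rule measurable_compose[OF measurable_compose[OF l measurable_snd] measurable_snd])
  show ?thesis unfolding child_def by measurable
qed

lemma short_lived_measurable: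
  assumes "\<And>e'. e' \<in> descendants e \<Longrightarrow> (\<lambda>w. \<Lambda> w e') \<in> measurable N life_space"
    and "\<And>e' ij. (\<lambda>w. \<sigma> w (e', ij)) \<in> measurable N (count_space UNIV)"
  shows "(\<lambda>w. short_lived x T n (\<Lambda> w) (\<sigma> w) e) \<in> measurable N (count_space UNIV)"
  using assms(1)
proof (induction n arbitrary: e)
  case (Suc n)
  have l: "(\<lambda>w. \<Lambda> w e) \<in> measurable N life_space"
    by (rule Suc.prems) (auto intro: range_eqI[of _ _ "[]"])
  have [measurable]: "(\<lambda>w. child (\<lambda>ij. \<sigma> w (e, ij)) (\<Lambda> w e) y) \<in> measurable N (count_space UNIV)" for y
    by (rule child_measurable[OF l assms(2)])
  have [measurable]: "(\<lambda>w. short_lived x T n (\<Lambda> w) (\<sigma> w) (y # e)) \<in> measurable N (count_space UNIV)" for y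
    using descendants_Cons_subset by (intro Suc.IH Suc.prems) auto
  have [measurable]: "(\<lambda>w. snd (snd (\<Lambda> w e))) \<in> measurable N borel"
    by (rule measurable_compose[OF measurable_compose[OF l measurable_snd] measurable_snd])
  show ?case by simp
qed simp

text \<open>
  The generating function of the number of children on the event that the life span is at most \<open>T\<close>,
  as computed in \<open>offspring_pgf\<close>.  This closed form shows that it is the same for all edges.
\<close>

definition offspring_pgf_upto :: "(real \<Rightarrow> real) \<Rightarrow> real \<Rightarrow> real \<Rightarrow> real \<Rightarrow> real \<Rightarrow> real" where
  "offspring_pgf_upto g b c T z =
     1 - survival_pgf g b c z T - (1 - g z) * (LBINT t=0..T. survival_pgf g b c z t)"

lemma (in prob_space) indep_var_imp_indep_pair: "indep_var S X T Y \<Longrightarrow> indep_pair S X T Y"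
  by (simp add: indep_var_eq indep_pair_def sets_vimage_algebra)

lemma (in prob_space) indep_pair_commute: "indep_pair S X T Y \<Longrightarrow> indep_pair T Y S X"
  unfolding indep_pair_def indep_sets2_eq by (metis Int_commute mult.commute)

locale random_cherry_tree_pos = random_cherry_tree +
  assumes b_pos: "0 < b" and c_pos: "0 < c" and p01: "p \<in> {0..1}"
begin

sublocale edge: edge_life_pos M b c p \<kappa> "\<pi> e" "K e" "\<phi> e" "L e" for e
  using edge_life[of e] b_pos c_pos by (simp add: edge_life_pos_def edge_life_pos_axioms_def)

abbreviation "g \<equiv> gen_fun (eps_pmf \<kappa> p)"

definition life :: "edge \<Rightarrow> 'a \<Rightarrow> life" where
  "life e \<omega> = (path (\<pi> e) \<omega>, (\<lambda>i. mark (K e) (\<phi> e) i \<omega>), L e \<omega>)"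

lemma life_indep: "indep_vars (\<lambda>_. life_space) life UNIV"
  using lives_indep unfolding life_def[abs_def] .

lemma life_measurable [measurable]: "life e \<in> measurable M life_space"
  using life_indep by (simp add: indep_vars_def)

definition children :: "(edge \<times> nat \<times> nat \<Rightarrow> bool) \<Rightarrow> edge \<Rightarrow> 'a \<Rightarrow> (nat \<times> nat \<times> bool) set" where
  "children \<sigma> e \<omega> = {y. child (\<lambda>ij. \<sigma> (e, ij)) (life e \<omega>) y}"

text \<open>
  Right-continuity of the Poisson process justifies the first conjunct of \<open>child\<close>.
\<close>

lemma event_in_life_iff_rational:
  assumes \<omega>: "\<omega> \<in> space M"
  shows "(\<forall>a b. L e \<omega> < real a / real (Suc b) \<longrightarrow> i < \<pi> e (real a / real (Suc b)) \<omega>) \<longleftrightarrow> i < \<pi> e (L e \<omega>) \<omega>"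
proof
  assume "i < \<pi> e (L e \<omega>) \<omega>"
  then show "\<forall>a b. L e \<omega> < real a / real (Suc b) \<longrightarrow> i < \<pi> e (real a / real (Suc b)) \<omega>"
    using edge.\<pi>_mono[OF \<omega>] edge.L_pos[OF \<omega>] by (meson less_imp_le less_le_trans)
next
  assume *: "\<forall>a b. L e \<omega> < real a / real (Suc b) \<longrightarrow> i < \<pi> e (real a / real (Suc b)) \<omega>"
  obtain \<delta> where \<delta>: "\<delta> > 0" "\<forall>r\<in>{L e \<omega>..<L e \<omega> + \<delta>}. \<pi> e r \<omega> = \<pi> e (L e \<omega>) \<omega>"
    using edge.\<pi>_right_continuous[OF \<omega> less_imp_le[OF edge.L_pos[OF \<omega>]]] by blast
  obtain b where b: "1 / real (Suc b) < \<delta>" using nat_approx_posE[OF \<delta>(1)] by auto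
  \<comment> \<open>The first multiple of \<open>1 / (b + 1)\<close> after the death of the edge.\<close>
  define a where "a = nat (\<lfloor>L e \<omega> * Suc b\<rfloor> + 1)"
  have "0 \<le> L e \<omega> * Suc b" using edge.L_pos[OF \<omega>, of e] by simp
  then have a: "L e \<omega> * Suc b < a" "a \<le> L e \<omega> * Suc b + 1"
    unfolding a_def by linarith+
  have "L e \<omega> < real a / real (Suc b)" using a(1) by (simp add: field_simps)
  moreover have "real a / real (Suc b) \<le> L e \<omega> + 1 / real (Suc b)" 
    using divide_right_mono[OF a(2), of "real (Suc b)"] by (simp add: add_divide_distrib del: of_nat_Suc)
  ultimately show "i < \<pi> e (L e \<omega>) \<omega>" using * \<delta>(2) b
    by (metis add_strict_left_mono atLeastLessThan_iff less_imp_le order_le_less_trans)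
qed

lemma children_iff:
  assumes "\<omega> \<in> space M"
  shows "(i, j, r) \<in> children \<sigma> e \<omega> \<longleftrightarrow>
    i < \<pi> e (L e \<omega>) \<omega> \<and> j < K e i \<omega> \<and> (\<phi> e i j \<omega> = 2 \<or> \<sigma> (e, i, j) = r)"
proof -
  have "0 \<le> real a / real (Suc b)" for a b by simp
  then show ?thesis
    using event_in_life_iff_rational[OF assms, of e i]
    by (simp add: children_def child_def life_def path_def mark_def del: of_nat_Suc)
qed

lemma children_eq_Sigma:
  assumes "\<omega> \<in> space M"
  shows "children \<sigma> e \<omega> = (SIGMA i:{..<\<pi> e (L e \<omega>) \<omega>}. SIGMA j:{..<K e i \<omega>}. {r. \<phi> e i j \<omega> = 2 \<or> \<sigma> (e, i, j) = r})"
  using children_iff[OF assms] by auto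

lemma finite_children: "\<omega> \<in> space M \<Longrightarrow> finite (children \<sigma> e \<omega>)"
  by (auto simp: children_eq_Sigma)

lemma AE_phi: "AE \<omega> in M. \<phi> e i j \<omega> \<in> {1, 2}"
proof -
  have "AE n in measure_pmf (phi_pmf p). n \<in> {1, 2}"
    by (auto simp: AE_measure_pmf_iff phi_pmf_def)
  then have "AE n in distr M (count_space UNIV) (\<phi> e i j). n \<in> {1, 2}"
    by (simp only: edge.\<phi>_law)
  then show ?thesis by (subst (asm) AE_distr_iff) auto
qed

text \<open>
  A cherry gives two labels and a semi-cherry one of the two, whichever endpoint was chosen.  Hence the number of
  children does not depend on \<open>\<sigma>\<close>.
\<close>

lemma card_children: "AE \<omega> in M. card (children \<sigma> e \<omega>) = edge.edges_at e (L e \<omega>) \<omega>"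
proof -
  have "AE \<omega> in M. \<forall>i j. \<phi> e i j \<omega> \<in> {1, 2}"
    using AE_phi by (simp add: AE_all_countable)
  with AE_space show ?thesis
  proof eventually_elim
    case (elim \<omega>)
    have card: "card {r. \<phi> e i j \<omega> = 2 \<or> \<sigma> (e, i, j) = r} = \<phi> e i j \<omega>" for i j
      using elim(2)[rule_format, of i j] by (auto simp: card_UNIV_bool)
    show ?case
      unfolding children_eq_Sigma[OF elim(1)] edge.edges_at_def total_edges_def new_edges_def
      by (simp add: card_SigmaI card)
  qed
qed

lemma of_bool_Ball_prod: "finite C \<Longrightarrow> (of_bool (\<forall>y\<in>C. P y) :: real) = (\<Prod>y\<in>C. of_bool (P y))"
  by (induction C rule: finite_induct) auto

text \<open>
  The branching property.  The life of \<open>e\<close> is independent of the lives of all its proper descendants, and the families of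
  descendants of different children are independent.  Hence given the life of \<open>e\<close>, every child
  contributes the factor \<open>u\<close>.
\<close>

lemma short_lived_recursion:
  assumes T: "0 < T" and u01: "0 \<le> u" "u \<le> 1"
    and u: "\<And>y. expectation (\<lambda>\<omega>. of_bool (short_lived x T n (\<lambda>e. life e \<omega>) \<sigma> (y # e))) = u"
  shows "expectation (\<lambda>\<omega>. of_bool (short_lived x T (Suc n) (\<lambda>e. life e \<omega>) \<sigma> e)) = offspring_pgf_upto g b c T u"
proof -
  define D where "D y \<Lambda> \<longleftrightarrow> short_lived x T n \<Lambda> \<sigma> (y # e)" for y \<Lambda>
  \<comment> \<open>The proper descendants of \<open>e\<close>.\<close>
  define B where "B = (\<Union>y. descendants (y # e))"
  have e_B: "e \<notin> B" by (auto simp: B_def)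
  have D_meas: "D y \<in> measurable (PiM S (\<lambda>_. life_space)) (count_space UNIV)"
    if "descendants (y # e) \<subseteq> S" for y S
    unfolding D_def[abs_def]
    by (rule short_lived_measurable[where \<Lambda> = "\<lambda>w. w" and \<sigma> = "\<lambda>_. \<sigma>"])
       (use that in \<open>auto intro!: measurable_component_singleton\<close>)
  have D_restrict: "D y (restrict \<Lambda> S) \<longleftrightarrow> D y \<Lambda>" if "descendants (y # e) \<subseteq> S" for y S \<Lambda>
    unfolding D_def by (rule short_lived_cong) (use that in auto)
  define F where "F \<Lambda>\<^sub>1 \<Lambda>\<^sub>2 = (of_bool (snd (snd (\<Lambda>\<^sub>1 e)) \<le> T \<and>
      (\<forall>y. child (\<lambda>ij. \<sigma> (e, ij)) (\<Lambda>\<^sub>1 e) y \<longrightarrow> D y \<Lambda>\<^sub>2)) :: real)" for \<Lambda>\<^sub>1 \<Lambda>\<^sub>2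
  have B: "descendants (y # e) \<subseteq> B" for y by (auto simp: B_def)
  let ?N = "PiM {e} (\<lambda>_. life_space) \<Otimes>\<^sub>M PiM B (\<lambda>_. life_space)"
  have l1: "(\<lambda>z. fst z e) \<in> measurable ?N life_space"
    by (rule measurable_compose[OF measurable_fst measurable_component_singleton]) simp
  have [measurable]: "(\<lambda>z. child (\<lambda>ij. \<sigma> (e, ij)) (fst z e) y) \<in> measurable ?N (count_space UNIV)" for y
    by (rule child_measurable[OF l1]) simp
  have [measurable]: "(\<lambda>z. D y (snd z)) \<in> measurable ?N (count_space UNIV)" for y
    by (rule measurable_compose[OF measurable_snd D_meas[OF B]])
  have [measurable]: "(\<lambda>z. snd (snd (fst z e))) \<in> measurable ?N borel"
    by (rule measurable_compose[OF measurable_compose[OF l1 measurable_snd] measurable_snd])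
  have F_meas: "(\<lambda>(\<Lambda>\<^sub>1, \<Lambda>\<^sub>2). F \<Lambda>\<^sub>1 \<Lambda>\<^sub>2) \<in> borel_measurable ?N"
    unfolding F_def case_prod_beta by measurable
  have F_bound: "\<bar>F \<Lambda>\<^sub>1 \<Lambda>\<^sub>2\<bar> \<le> 1" for \<Lambda>\<^sub>1 \<Lambda>\<^sub>2 by (simp add: F_def)
  have "indep_var (PiM {e} (\<lambda>_. life_space)) (\<lambda>\<omega>. \<lambda>e\<in>{e}. life e \<omega>) (PiM B (\<lambda>_. life_space)) (\<lambda>\<omega>. \<lambda>e\<in>B. life e \<omega>)"
    by (rule indep_var_restrict[OF life_indep]) (use e_B in auto)
  note pair = indep_var_imp_indep_pair[OF this]
  have F_eq: "F (\<lambda>e\<in>{e}. life e \<omega>') (\<lambda>e\<in>B. life e \<omega>)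
      = indicator {\<omega> \<in> space M. L e \<omega> \<le> T} \<omega>' * (\<Prod>y\<in>children \<sigma> e \<omega>'. of_bool (D y (\<lambda>e. life e \<omega>)))"
    if "\<omega>' \<in> space M" for \<omega> \<omega>'
    unfolding F_def D_restrict[OF B] of_bool_Ball_prod[OF finite_children[OF that], symmetric]
    using that by (auto simp: children_def life_def)
  have inner: "expectation (\<lambda>\<omega>. \<Prod>y\<in>C. of_bool (D y (\<lambda>e. life e \<omega>))) = u ^ card C" if "finite C" for C
  proof -
    have "indep_vars (\<lambda>y. PiM (descendants (y # e)) (\<lambda>_. life_space))
        (\<lambda>y \<omega>. \<lambda>e\<in>descendants (y # e). life e \<omega>) C"
      by (rule indep_vars_restrict[OF life_indep]) (auto simp: disjoint_family_on_def append_eq_append_conv2 append_eq_Cons_conv Cons_eq_append_conv)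
    then have "indep_vars (\<lambda>_. borel) (\<lambda>y \<omega>. of_bool (D y (\<lambda>e\<in>descendants (y # e). life e \<omega>)) :: real) C"
      by (rule indep_vars_compose2[where Y = "\<lambda>y \<Lambda>. of_bool (D y \<Lambda>)"])
         (rule measurable_compose[OF D_meas], auto)
    then have ind: "indep_vars (\<lambda>_. borel) (\<lambda>y \<omega>. of_bool (D y (\<lambda>e. life e \<omega>)) :: real) C"
      by (simp add: D_restrict)
    have "expectation (\<lambda>\<omega>. \<Prod>y\<in>C. of_bool (D y (\<lambda>e. life e \<omega>)) :: real)
        = (\<Prod>y\<in>C. expectation (\<lambda>\<omega>. of_bool (D y (\<lambda>e. life e \<omega>))))"
    proof (rule indep_vars_lebesgue_integral[OF that ind])
      fix y assume "y \<in> C"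
      then have "(\<lambda>\<omega>. of_bool (D y (\<lambda>e. life e \<omega>)) :: real) \<in> borel_measurable M"
        using ind by (simp add: indep_vars_def)
      then show "integrable M (\<lambda>\<omega>. of_bool (D y (\<lambda>e. life e \<omega>)) :: real)"
        by (intro integrable_const_bound[where B = 1]) auto
    qed
    then show ?thesis using u by (simp add: D_def)
  qed
  have "expectation (\<lambda>\<omega>. of_bool (short_lived x T (Suc n) (\<lambda>e. life e \<omega>) \<sigma> e))
      = expectation (\<lambda>\<omega>. F (\<lambda>e\<in>{e}. life e \<omega>) (\<lambda>e\<in>B. life e \<omega>))"
    unfolding F_def D_restrict[OF B] by (simp add: D_def)
  also have "\<dots> = expectation (\<lambda>\<omega>'. expectation (\<lambda>\<omega>. F (\<lambda>e\<in>{e}. life e \<omega>') (\<lambda>e\<in>B. life e \<omega>)))"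
    by (rule expectation_indep_pair[OF pair F_meas F_bound])
  also have "\<dots> = expectation (\<lambda>\<omega>. u ^ edge.edges_at e (L e \<omega>) \<omega> * indicator {\<omega> \<in> space M. L e \<omega> \<le> T} \<omega>)"
  proof (rule integral_cong_AE)
    have [measurable]: "(\<lambda>\<omega>. \<lambda>e\<in>{e}. life e \<omega>) \<in> measurable M (PiM {e} (\<lambda>_. life_space))"
      "(\<lambda>\<omega>. \<lambda>e\<in>B. life e \<omega>) \<in> measurable M (PiM B (\<lambda>_. life_space))"
      using pair by (simp_all add: indep_pair_def)
    have "(\<lambda>z. (\<lambda>e\<in>{e}. life e (fst z), \<lambda>e\<in>B. life e (snd z))) \<in> measurable (M \<Otimes>\<^sub>M M) ?N"
      by (rule measurable_Pair; rule measurable_compose[where N = M]) measurable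
    from measurable_compose[OF this F_meas]
    show "(\<lambda>\<omega>'. expectation (\<lambda>\<omega>. F (\<lambda>e\<in>{e}. life e \<omega>') (\<lambda>e\<in>B. life e \<omega>))) \<in> borel_measurable M"
      by (intro borel_measurable_lebesgue_integral) (simp add: case_prod_beta')
    show "(\<lambda>\<omega>. u ^ edge.edges_at e (L e \<omega>) \<omega> * indicator {\<omega> \<in> space M. L e \<omega> \<le> T} \<omega>) \<in> borel_measurable M"
      by (rule edge.offspring_pgf(1)[OF u01 T])
    show "AE \<omega>' in M. expectation (\<lambda>\<omega>. F (\<lambda>e\<in>{e}. life e \<omega>') (\<lambda>e\<in>B. life e \<omega>))
        = u ^ edge.edges_at e (L e \<omega>') \<omega>' * indicator {\<omega> \<in> space M. L e \<omega> \<le> T} \<omega>'"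
      using card_children[of \<sigma> e] AE_space
      by eventually_elim (simp add: F_eq inner finite_children)
  qed
  also have "\<dots> = offspring_pgf_upto g b c T u"
    unfolding offspring_pgf_upto_def by (rule edge.offspring_pgf(2)[OF u01 T])
  finally show ?thesis .
qed

lemma short_lived_pred [measurable]:
  "Measurable.pred M (\<lambda>\<omega>. short_lived x T n (\<lambda>e. life e \<omega>) \<sigma> e)"
  by (rule short_lived_measurable) auto

lemma short_lived_fixed_choices:
  assumes T: "0 < T"
  shows "(offspring_pgf_upto g b c T ^^ n) (of_bool x) \<in> {0..1} \<and>
    (\<forall>e. expectation (\<lambda>\<omega>. of_bool (short_lived x T n (\<lambda>e. life e \<omega>) \<sigma> e)) = (offspring_pgf_upto g b c T ^^ n) (of_bool x))"
proof (induction n)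
  case (Suc n)
  let ?u = "(offspring_pgf_upto g b c T ^^ n) (of_bool x)"
  have eq: "expectation (\<lambda>\<omega>. of_bool (short_lived x T (Suc n) (\<lambda>e. life e \<omega>) \<sigma> e)) = offspring_pgf_upto g b c T ?u" for e
    by (rule short_lived_recursion[OF T]) (use Suc in auto)
  have "offspring_pgf_upto g b c T ?u \<in> {0..1}"
    unfolding eq[symmetric, of "[]"]
    by (auto intro!: Bochner_Integration.integral_nonneg integral_le_const integrable_const_bound[where B = 1] simp del: short_lived.simps)
  with eq show ?case by simp
qed (simp add: prob_space)

text \<open>
  The lives are independent of the choices of the endpoints, so the choices may be treated as constants.
\<close>

theorem prob_short_lived:
  assumes T: "0 < T"
  shows "prob {\<omega> \<in> space M. short_lived x T n (\<lambda>e. life e \<omega>) (\<lambda>(e, i, j). s e i j \<omega>) []}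
       = (offspring_pgf_upto g b c T ^^ n) (of_bool x)"
proof -
  let ?LS = "PiM (UNIV :: edge set) (\<lambda>_. life_space)" and ?CS = "PiM (UNIV :: (edge \<times> nat \<times> nat) set) (\<lambda>_. count_space (UNIV :: bool set))"
  let ?F = "\<lambda>\<sigma> \<Lambda>. of_bool (short_lived x T n \<Lambda> \<sigma> []) :: real"
  have pair: "indep_pair ?CS (\<lambda>\<omega> (e, i, j). s e i j \<omega>) ?LS (\<lambda>\<omega> e. life e \<omega>)"
    using lives_choices_indep unfolding life_def by (rule indep_pair_commute)
  have [measurable]: "(\<lambda>z. short_lived x T n (snd z) (fst z) []) \<in> measurable (?CS \<Otimes>\<^sub>M ?LS) (count_space UNIV)"
    by (rule short_lived_measurable)
       (auto intro: measurable_compose[OF measurable_snd measurable_component_singleton]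
          measurable_compose[OF measurable_fst measurable_component_singleton])
  have F: "(\<lambda>(\<sigma>, \<Lambda>). ?F \<sigma> \<Lambda>) \<in> borel_measurable (?CS \<Otimes>\<^sub>M ?LS)"
    unfolding case_prod_beta by measurable
  have [measurable]: "Measurable.pred M (\<lambda>\<omega>. short_lived x T n (\<lambda>e. life e \<omega>) (\<lambda>(e, i, j). s e i j \<omega>) [])"
  proof (rule short_lived_measurable)
    fix e ij
    have "(\<lambda>\<omega>. (\<lambda>(e, i, j). s e i j \<omega>) (e, ij)) \<in> measurable M (count_space UNIV)"
      using choices_indep by (cases ij) (auto simp: indep_vars_def)
    then show "(\<lambda>\<omega>. case (e, ij) of (e, i, j) \<Rightarrow> s e i j \<omega>) \<in> measurable M (count_space UNIV)"
      by simp
  qed simp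
  have "prob {\<omega> \<in> space M. short_lived x T n (\<lambda>e. life e \<omega>) (\<lambda>(e, i, j). s e i j \<omega>) []}
      = expectation (indicator {\<omega> \<in> space M. short_lived x T n (\<lambda>e. life e \<omega>) (\<lambda>(e, i, j). s e i j \<omega>) []})"
    by simp
  also have "\<dots> = expectation (\<lambda>\<omega>. ?F (\<lambda>(e, i, j). s e i j \<omega>) (\<lambda>e. life e \<omega>))"
    by (rule Bochner_Integration.integral_cong) (auto simp: indicator_def)
  also have "\<dots> = expectation (\<lambda>\<omega>'. expectation (\<lambda>\<omega>. ?F (\<lambda>(e, i, j). s e i j \<omega>') (\<lambda>e. life e \<omega>)))"
    by (rule expectation_indep_pair[OF pair F, of 1]) simp
  also have "\<dots> = (offspring_pgf_upto g b c T ^^ n) (of_bool x)"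
    using short_lived_fixed_choices[OF T, of n x] by (simp add: prob_space)
  finally show ?thesis .
qed

end


section \<open>The extinction event\<close>

context random_cherry_tree_pos
begin

abbreviation choices :: "'a \<Rightarrow> edge \<times> nat \<times> nat \<Rightarrow> bool" where
  "choices \<omega> \<equiv> (\<lambda>(e, i, j). s e i j \<omega>)"

lemma ever_born_Cons:
  "\<omega> \<in> space M \<Longrightarrow> ever_born \<omega> (y # e) \<longleftrightarrow> ever_born \<omega> e \<and> y \<in> children (choices \<omega>) e \<omega>"
  by (cases y) (auto simp: children_iff adds_vertex_def)

lemma ever_born_append: "ever_born \<omega> (ys @ e) \<Longrightarrow> ever_born \<omega> e"
  by (induction ys) auto

text \<open>
  Every generation is finite because every edge has finitely many children.
\<close>

lemma short_lived_imp_finite: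
  assumes \<omega>: "\<omega> \<in> space M"
    and "short_lived False T n (\<lambda>e. life e \<omega>) (choices \<omega>) e"
  shows "finite {e' \<in> descendants e. ever_born \<omega> e'}"
  using assms(2)
proof (induction n arbitrary: e)
  case (Suc n)
  let ?D = "\<lambda>e. {e' \<in> descendants e. ever_born \<omega> e'}"
  have "?D e \<subseteq> {e} \<union> (\<Union>y\<in>children (choices \<omega>) e \<omega>. ?D (y # e))"
  proof
    fix e' assume "e' \<in> ?D e"
    then obtain ys where ys: "e' = ys @ e" "ever_born \<omega> (ys @ e)" by auto
    show "e' \<in> {e} \<union> (\<Union>y\<in>children (choices \<omega>) e \<omega>. ?D (y # e))"
    proof (cases ys rule: rev_cases)
      case (snoc zs y)
      then have "ever_born \<omega> (zs @ y # e)" using ys by simp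
      then have "y \<in> children (choices \<omega>) e \<omega>"
        using ever_born_append[of \<omega> zs "y # e"] ever_born_Cons[OF \<omega>] by simp
      then show ?thesis using snoc ys by auto
    qed (use ys in simp)
  qed
  moreover have "finite (?D (y # e))" if "y \<in> children (choices \<omega>) e \<omega>" for y
    using Suc.prems that by (intro Suc.IH) (cases y, auto simp: children_def)
  ultimately show ?case
    using finite_children[OF \<omega>] by (meson finite.emptyI finite.insertI finite_UN_I finite_Un finite_subset)
qed simp

text \<open>
  The infimum in the definition of the age is attained by right-continuity.
\<close>

lemma event_age_le_iff:
  assumes \<omega>: "\<omega> \<in> space M" and u: "0 \<le> u" "i < \<pi> e u \<omega>"
  shows "event_age e i \<omega> \<le> a \<longleftrightarrow> 0 \<le> a \<and> i < \<pi> e a \<omega>"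
proof -
  let ?S = "{t. 0 \<le> t \<and> i < \<pi> e t \<omega>}"
  have S: "?S \<noteq> {}" "bdd_below ?S" using u by auto
  have nonneg: "0 \<le> Inf ?S" using S(1) by (intro cInf_greatest) auto
  show ?thesis
  proof
    assume le: "event_age e i \<omega> \<le> a"
    obtain \<delta> where \<delta>: "\<delta> > 0" "\<forall>r\<in>{Inf ?S..<Inf ?S + \<delta>}. \<pi> e r \<omega> = \<pi> e (Inf ?S) \<omega>"
      using edge.\<pi>_right_continuous[OF \<omega> nonneg] by blast
    have "Inf ?S < Inf ?S + \<delta>" using \<delta>(1) by simp
    from cInf_lessD[OF S(1) this] obtain t where t: "t \<in> ?S" "t < Inf ?S + \<delta>" by blast
    moreover have "Inf ?S \<le> t" using t(1) S(2) by (rule cInf_lower)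
    ultimately have "\<pi> e t \<omega> = \<pi> e (Inf ?S) \<omega>" using \<delta>(2)[rule_format, of t] by simp
    then have "i < \<pi> e (Inf ?S) \<omega>" using t(1) by simp
    also have "\<dots> \<le> \<pi> e a \<omega>"
      using edge.\<pi>_mono[OF \<omega> nonneg] le by (simp add: event_age_def)
    finally show "0 \<le> a \<and> i < \<pi> e a \<omega>" using nonneg le by (simp add: event_age_def)
  next
    assume "0 \<le> a \<and> i < \<pi> e a \<omega>"
    then show "event_age e i \<omega> \<le> a"
      unfolding event_age_def by (intro cInf_lower S(2)) simp
  qed
qed

lemma event_age_nonneg:
  assumes "0 \<le> u" "i < \<pi> e u \<omega>"
  shows "0 \<le> event_age e i \<omega>"
  unfolding event_age_def by (rule cInf_greatest) (use assms in auto)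

lemma birth_time_nonneg: "\<omega> \<in> space M \<Longrightarrow> ever_born \<omega> e \<Longrightarrow> 0 \<le> birth_time \<omega> e"
proof (induction e)
  case (Cons y e)
  obtain i j r where "y = (i, j, r)" by (cases y)
  moreover have "0 \<le> event_age e i \<omega>"
    using Cons.prems calculation edge.L_pos[of \<omega> e]
    by (intro event_age_nonneg[of "L e \<omega>"]) (auto simp: adds_vertex_def)
  ultimately show ?case using Cons by simp
qed simp

text \<open>
  Edges have positive life spans, so every edge is alive at its time of birth.  This form of the event involves only
  countably many times and edges, which gives its measurability.
\<close>

lemma extinct_iff:
  assumes \<omega>: "\<omega> \<in> space M"
  shows "extinct \<omega> \<longleftrightarrow> (\<exists>T :: nat. \<forall>e. ever_born \<omega> e \<longrightarrow> birth_time \<omega> e + L e \<omega> \<le> T)"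
proof
  assume "extinct \<omega>"
  then obtain T where T: "T \<ge> 0" "\<And>t. t \<ge> T \<Longrightarrow> alive_edges t \<omega> = {}"
    by (auto simp: extinct_def cherry_tree_def graph_edges_def)
  obtain n :: nat where n: "T \<le> n" using real_arch_simple by blast
  have "birth_time \<omega> e + L e \<omega> \<le> n" if "ever_born \<omega> e" for e
  proof (rule ccontr)
    assume "\<not> birth_time \<omega> e + L e \<omega> \<le> n"
    then have "e \<in> alive_edges (max T (birth_time \<omega> e)) \<omega>"
      using that n edge.L_pos[OF \<omega>, of e] by (auto simp: alive_edges_def)
    then show False using T(2)[of "max T (birth_time \<omega> e)"] by simp
  qed
  then show "\<exists>T :: nat. \<forall>e. ever_born \<omega> e \<longrightarrow> birth_time \<omega> e + L e \<omega> \<le> T" by blast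
next
  assume "\<exists>T :: nat. \<forall>e. ever_born \<omega> e \<longrightarrow> birth_time \<omega> e + L e \<omega> \<le> T"
  then obtain T :: nat where "\<And>e. ever_born \<omega> e \<Longrightarrow> birth_time \<omega> e + L e \<omega> \<le> T" by blast
  then have "alive_edges t \<omega> = {}" if "t \<ge> T" for t :: real
    using that by (force simp: alive_edges_def)
  then show "extinct \<omega>"
    unfolding extinct_def by (intro exI[of _ "real T"]) (auto simp: cherry_tree_def graph_edges_def)
qed

lemma finite_imp_extinct:
  assumes "\<omega> \<in> space M" "finite {e. ever_born \<omega> e}"
  shows "extinct \<omega>"
proof -
  let ?S = "(\<lambda>e. birth_time \<omega> e + L e \<omega>) ` {e. ever_born \<omega> e}"
  obtain T :: nat where "Max ?S \<le> T" using real_arch_simple by blast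
  moreover have "birth_time \<omega> e + L e \<omega> \<le> Max ?S" if "ever_born \<omega> e" for e
    using assms(2) that by (intro Max_ge) auto
  ultimately show ?thesis unfolding extinct_iff[OF assms(1)] by (meson order_trans)
qed

lemma short_lived_imp_extinct:
  assumes "\<omega> \<in> space M" "short_lived False T n (\<lambda>e. life e \<omega>) (choices \<omega>) []"
  shows "extinct \<omega>"
  using finite_imp_extinct[OF assms(1)] short_lived_imp_finite[OF assms] by simp

text \<open>
  All birth times are nonnegative, so every edge that is gone by time \<open>T\<close> has lived at most \<open>T\<close>.  The converse
  holds up to a null set, by the uniqueness of the fixed points of the truncated generating functions.
\<close>

lemma extinct_imp_short_lived:
  assumes \<omega>: "\<omega> \<in> space M" and "extinct \<omega>"
  shows "\<exists>T :: nat. \<forall>n. short_lived True (Suc T) n (\<lambda>e. life e \<omega>) (choices \<omega>) []"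
proof -
  obtain T :: nat where T: "\<And>e. ever_born \<omega> e \<Longrightarrow> birth_time \<omega> e + L e \<omega> \<le> T"
    using assms extinct_iff by blast
  have L: "L e \<omega> \<le> Suc T" if "ever_born \<omega> e" for e
    using T[OF that] birth_time_nonneg[OF \<omega> that] by simp
  have "short_lived True (Suc T) n (\<lambda>e. life e \<omega>) (choices \<omega>) e" if "ever_born \<omega> e" for n e
    using that
  proof (induction n arbitrary: e)
    case (Suc n)
    then have "short_lived True (Suc T) n (\<lambda>e. life e \<omega>) (choices \<omega>) (y # e)"
      if "y \<in> children (choices \<omega>) e \<omega>" for y
      using that by (simp add: ever_born_Cons[OF \<omega>])
    then show ?case using L[OF Suc.prems] by (auto simp: children_def life_def)
  qed simp
  then show ?thesis by (intro exI[of _ T]) simp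
qed

lemma event_age_measurable [measurable]: "event_age e i \<in> borel_measurable M"
proof (rule borel_measurableI_le)
  fix a :: real
  \<comment> \<open>If the event never happens, its age is the unspecified but constant infimum of the empty set.\<close>
  have "{\<omega> \<in> space M. event_age e i \<omega> \<le> a} =
      {\<omega> \<in> space M. if \<exists>m :: nat. i < \<pi> e m \<omega> then 0 \<le> a \<and> i < \<pi> e (max 0 a) \<omega> else Inf ({} :: real set) \<le> a}"
  proof (intro Collect_cong conj_cong refl)
    fix \<omega> assume \<omega>: "\<omega> \<in> space M"
    show "event_age e i \<omega> \<le> a \<longleftrightarrow>
        (if \<exists>m :: nat. i < \<pi> e m \<omega> then 0 \<le> a \<and> i < \<pi> e (max 0 a) \<omega> else Inf ({} :: real set) \<le> a)"
    proof (cases "\<exists>m :: nat. i < \<pi> e m \<omega>")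
      case True
      then obtain m :: nat where "i < \<pi> e m \<omega>" by blast
      then show ?thesis using True event_age_le_iff[OF \<omega>, of m i e a] by (auto simp: max_def)
    next
      case False
      have empty: "{t. 0 \<le> t \<and> i < \<pi> e t \<omega>} = {}"
      proof (rule ccontr)
        assume "{t. 0 \<le> t \<and> i < \<pi> e t \<omega>} \<noteq> {}"
        then obtain t where t: "0 \<le> t" "i < \<pi> e t \<omega>" by blast
        obtain m :: nat where "t \<le> m" using real_arch_simple by blast
        then have "i < \<pi> e m \<omega>" using t edge.\<pi>_mono[OF \<omega> t(1)] by (meson less_le_trans)
        with False show False by blast
      qed
      show ?thesis unfolding event_age_def empty using False by simp
    qed
  qed
  also have "\<dots> \<in> sets M" by measurable
  finally show "{\<omega> \<in> space M. event_age e i \<omega> \<le> a} \<in> sets M" .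
qed

lemma s_measurable [measurable]: "s e i j \<in> measurable M (count_space UNIV)"
  using choices_indep by (auto simp: indep_vars_def)

lemma children_measurable [measurable]: "Measurable.pred M (\<lambda>\<omega>. y \<in> children (choices \<omega>) e \<omega>)"
  unfolding children_def mem_Collect_eq
  by (rule child_measurable) (auto simp: case_prod_beta)

lemma ever_born_measurable [measurable]: "Measurable.pred M (\<lambda>\<omega>. ever_born \<omega> e)"
proof (induction e)
  case (Cons y e)
  note Cons [measurable]
  have "Measurable.pred M (\<lambda>\<omega>. ever_born \<omega> e \<and> y \<in> children (choices \<omega>) e \<omega>)" by measurable
  then show ?case by (rule measurable_cong[THEN iffD1, rotated]) (simp add: ever_born_Cons)
qed simp

lemma birth_time_measurable [measurable]: "(\<lambda>\<omega>. birth_time \<omega> e) \<in> borel_measurable M"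
proof (induction e)
  case (Cons y e)
  note Cons [measurable]
  show ?case by (cases y) simp
qed simp

lemma extinct_measurable [measurable]: "Measurable.pred M extinct"
proof -
  have "Measurable.pred M (\<lambda>\<omega>. \<exists>T :: nat. \<forall>e. ever_born \<omega> e \<longrightarrow> birth_time \<omega> e + L e \<omega> \<le> T)"
    by measurable
  then show ?thesis by (rule measurable_cong[THEN iffD1, rotated]) (simp add: extinct_iff)
qed

lemma short_lived_choices_pred [measurable]:
  "Measurable.pred M (\<lambda>\<omega>. short_lived x T n (\<lambda>e. life e \<omega>) (choices \<omega>) e)"
  by (rule short_lived_measurable) (auto simp: case_prod_beta)

lemma iterate_le_prob_extinct:
  assumes "0 < T"
  shows "(offspring_pgf_upto g b c T ^^ n) 0 \<le> prob {\<omega> \<in> space M. extinct \<omega>}"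
proof -
  have "prob {\<omega> \<in> space M. short_lived False T n (\<lambda>e. life e \<omega>) (choices \<omega>) []} \<le> prob {\<omega> \<in> space M. extinct \<omega>}"
    by (rule finite_measure_mono) (auto intro: short_lived_imp_extinct)
  then show ?thesis using prob_short_lived[OF assms, where x = False and n = n] by simp
qed

lemma short_lived_Suc_imp:
  "short_lived True T (Suc n) \<Lambda> \<sigma> e \<Longrightarrow> short_lived True T n \<Lambda> \<sigma> e"
  by (induction n arbitrary: e) auto

lemma short_lived_mono: "T \<le> T' \<Longrightarrow> short_lived x T n \<Lambda> \<sigma> e \<Longrightarrow> short_lived x T' n \<Lambda> \<sigma> e"
  by (induction n arbitrary: e) auto

text \<open>
  Continuity of the probability, first as the number of generations and then as the bound on the life spans tends to
  infinity.
\<close>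

lemma prob_extinct_le:
  assumes r: "\<And>T :: nat. (\<lambda>n. (offspring_pgf_upto g b c (Suc T) ^^ n) 1) \<longlonglongrightarrow> r T" and r_le: "\<And>T. r T \<le> q"
  shows "prob {\<omega> \<in> space M. extinct \<omega>} \<le> q"
proof -
  let ?E = "\<lambda>T n. {\<omega> \<in> space M. short_lived True (real (Suc T)) n (\<lambda>e. life e \<omega>) (choices \<omega>) []}"
  define A where "A T = (\<Inter>n. ?E T n)" for T
  have [measurable]: "A T \<in> sets M" for T unfolding A_def by measurable
  have lim: "(\<lambda>n. prob (?E T n)) \<longlonglongrightarrow> prob (A T)" for T
    unfolding A_def
    by (rule finite_Lim_measure_decseq) (auto simp: decseq_Suc_iff intro: short_lived_Suc_imp)
  have "(\<lambda>n. (offspring_pgf_upto g b c (Suc T) ^^ n) 1) \<longlonglongrightarrow> prob (A T)" for T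
    using lim[of T] prob_short_lived[where T = "real (Suc T)" and x = True] by simp
  then have prob_A: "prob (A T) \<le> q" for T
    using LIMSEQ_unique[OF r] r_le by metis
  have "incseq A"
    unfolding A_def incseq_Suc_iff
    using short_lived_mono[of "real (Suc T)" "real (Suc (Suc T))" for T] by auto
  then have "(\<lambda>T. prob (A T)) \<longlonglongrightarrow> prob (\<Union>T. A T)"
    by (intro finite_Lim_measure_incseq) auto
  then have "prob (\<Union>T. A T) \<le> q"
    by (rule LIMSEQ_le_const2) (use prob_A in auto)
  moreover have "prob {\<omega> \<in> space M. extinct \<omega>} \<le> prob (\<Union>T. A T)"
  proof (rule finite_measure_mono)
    show "{\<omega> \<in> space M. extinct \<omega>} \<subseteq> (\<Union>T. A T)"
      using extinct_imp_short_lived unfolding A_def by fastforce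
  qed simp
  ultimately show ?thesis by simp
qed

end


section \<open>The least fixed point\<close>

text \<open>
  Convexity of the power function along the segment from \<open>d\<close> to 1.
\<close>

lemma power_convex_combination_one:
  fixes d a :: real
  assumes "0 \<le> d" "d \<le> 1" "0 \<le> a" "a \<le> 1"
  shows "(a * d + (1 - a)) ^ n \<le> a * d ^ n + (1 - a)"
proof (induction n)
  case (Suc n)
  have "0 \<le> a * (1 - a) * ((1 - d) * (1 - d ^ n))"
    using assms by (intro mult_nonneg_nonneg) (auto simp: power_le_one)
  then have "(a * d + (1 - a)) * (a * d ^ n + (1 - a)) \<le> a * d ^ Suc n + (1 - a)"
    by (simp add: algebra_simps)
  moreover have "(a * d + (1 - a)) ^ Suc n \<le> (a * d + (1 - a)) * (a * d ^ n + (1 - a))"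
    using Suc assms by (simp add: mult_left_mono)
  ultimately show ?case by linarith
qed simp

text \<open>
  The iterates from 0 increase and those from 1 decrease, each to a fixed point.  Two different fixed points are impossible
  because \<open>h\<close> lies below its chord from the smaller one to 1, while \<open>h 1 < 1\<close>.
\<close>

lemma iterates_converge_to_unique_fixpoint:
  fixes h :: "real \<Rightarrow> real"
  assumes cont: "continuous_on {0..1} h"
    and mono: "\<And>x y. 0 \<le> x \<Longrightarrow> x \<le> y \<Longrightarrow> y \<le> 1 \<Longrightarrow> h x \<le> h y"
    and h0: "0 \<le> h 0" and h1: "h 1 < 1"
    and convex: "\<And>a d. a \<in> {0..1} \<Longrightarrow> d \<in> {0..1} \<Longrightarrow> h (a * d + (1 - a)) \<le> a * h d + (1 - a) * h 1"
  obtains r where "r \<in> {0..1}" "h r = r" "(\<lambda>n. (h ^^ n) 0) \<longlonglongrightarrow> r" "(\<lambda>n. (h ^^ n) 1) \<longlonglongrightarrow> r"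
proof -
  have h01: "h x \<in> {0..1}" if "x \<in> {0..1}" for x
    using mono[of 0 x] mono[of x 1] h0 h1 that by auto
  have it: "(h ^^ n) x \<in> {0..1}" if "x \<in> {0..1}" for x n
    by (induction n) (use that h01 in auto)
  have lim_fix: "h r = r \<and> r \<in> {0..1}" if x: "x \<in> {0..1}" and r: "(\<lambda>n. (h ^^ n) x) \<longlonglongrightarrow> r" for x r
  proof
    show r01: "r \<in> {0..1}"
      using closed_sequentially[OF closed_atLeastAtMost _ r] it[OF x] by auto
    have "(\<lambda>n. h ((h ^^ n) x)) \<longlonglongrightarrow> h r"
      by (rule continuous_on_tendsto_compose[OF cont r r01]) (use it[OF x] in auto)
    then have "(\<lambda>n. (h ^^ Suc n) x) \<longlonglongrightarrow> h r" by simp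
    then show "h r = r" using LIMSEQ_Suc[OF r] LIMSEQ_unique by blast
  qed
  have "(h ^^ n) 0 \<le> (h ^^ Suc n) 0" for n
  proof (induction n)
    case (Suc n)
    then show ?case using it[of 0 n] it[of 0 "Suc n"] by (simp add: mono)
  qed (use h0 in simp)
  then have "incseq (\<lambda>n. (h ^^ n) 0)" by (rule incseq_SucI)
  then obtain d where d: "(\<lambda>n. (h ^^ n) 0) \<longlonglongrightarrow> d"
    by (rule incseq_convergent[where B = 1]) (use it[of 0] in auto)
  have "(h ^^ Suc n) 1 \<le> (h ^^ n) 1" for n
  proof (induction n)
    case (Suc n)
    then show ?case using it[of 1 n] it[of 1 "Suc n"] by (simp add: mono)
  qed (use h1 in simp)
  then have "decseq (\<lambda>n. (h ^^ n) 1)" by (rule decseq_SucI)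
  then obtain u where u: "(\<lambda>n. (h ^^ n) 1) \<longlonglongrightarrow> u"
    by (rule decseq_convergent[where B = 0]) (use it[of 1] in auto)
  have fix_d: "h d = d" "d \<in> {0..1}" and fix_u: "h u = u" "u \<in> {0..1}"
    using lim_fix[OF _ d] lim_fix[OF _ u] by auto
  have "(h ^^ n) 0 \<le> (h ^^ n) 1" for n
  proof (induction n)
    case (Suc n)
    then show ?case using it[of 0 n] it[of 1 n] by (simp add: mono)
  qed simp
  then have "d \<le> u" by (intro LIMSEQ_le[OF d u]) auto
  have "d = u"
  proof (rule ccontr)
    assume "d \<noteq> u"
    with \<open>d \<le> u\<close> have "d < u" by simp
    have "u < 1" using fix_u h1 by (cases "u = 1") auto
    \<comment> \<open>The weight for which \<open>u\<close> is the convex combination of \<open>d\<close> and 1.\<close>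
    define a where "a = (1 - u) / (1 - d)"
    have a: "a \<in> {0..1}" "a < 1"
      using \<open>d < u\<close> \<open>u < 1\<close> by (auto simp: a_def field_simps)
    have "1 - d \<noteq> 0" using \<open>d < u\<close> \<open>u < 1\<close> by simp
    then have "a * (1 - d) = 1 - u" by (simp add: a_def)
    then have u_eq: "a * d + (1 - a) = u" by (simp add: algebra_simps)
    have "u \<le> a * d + (1 - a) * h 1"
      using convex[OF a(1) fix_d(2)] unfolding u_eq fix_d(1) fix_u(1) .
    also have "\<dots> < a * d + (1 - a) * 1" using a(2) h1 by simp
    finally show False using u_eq by simp
  qed
  then show thesis using that fix_d d u by blast
qed

context random_cherry_tree_pos
begin

abbreviation offspring :: "'a \<Rightarrow> nat" where
  "offspring \<omega> \<equiv> edge.edges_at [] (L [] \<omega>) \<omega>"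

abbreviation "short T \<equiv> (indicator {\<omega> \<in> space M. L [] \<omega> \<le> T} :: 'a \<Rightarrow> real)"

lemma offspring_pgf_upto_eq:
  "0 \<le> z \<Longrightarrow> z \<le> 1 \<Longrightarrow> 0 < T \<Longrightarrow>
   offspring_pgf_upto g b c T z = expectation (\<lambda>\<omega>. z ^ offspring \<omega> * short T \<omega>)"
  unfolding offspring_pgf_upto_def by (rule edge.offspring_pgf(2)[symmetric])

lemma offspring_measurable [measurable]:
  "0 \<le> z \<Longrightarrow> z \<le> 1 \<Longrightarrow> 0 < T \<Longrightarrow> (\<lambda>\<omega>. z ^ offspring \<omega> * short T \<omega>) \<in> borel_measurable M"
  by (rule edge.offspring_pgf(1))

lemma offspring_bounded: "0 \<le> z \<Longrightarrow> z \<le> 1 \<Longrightarrow> \<bar>z ^ offspring \<omega> * short T \<omega>\<bar> \<le> 1"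
  by (auto simp: indicator_def power_le_one)

lemma offspring_integrable:
  assumes "0 \<le> z" "z \<le> 1" "0 < T"
  shows "integrable M (\<lambda>\<omega>. z ^ offspring \<omega> * short T \<omega>)"
proof (rule integrable_const_bound[where B = 1])
  show "AE \<omega> in M. norm (z ^ offspring \<omega> * short T \<omega>) \<le> 1"
    unfolding real_norm_def by (intro AE_I2 offspring_bounded assms)
qed (rule offspring_measurable[OF assms])

lemma short_LIMSEQ:
  assumes "\<omega> \<in> space M"
  shows "(\<lambda>n. short (Suc n) \<omega>) \<longlonglongrightarrow> 1"
proof (rule tendsto_eventually)
  obtain m :: nat where m: "L [] \<omega> \<le> m" using real_arch_simple by blast
  have "short (Suc n) \<omega> = 1" if "n \<ge> m" for n
    using m that assms by (simp add: indicator_def)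
  then show "\<forall>\<^sub>F n in sequentially. short (Suc n) \<omega> = 1"
    unfolding eventually_sequentially by blast
qed

text \<open>
  The argument may vary together with the bound on the life spans, so that one can pass to the limit in the fixed
  point equation of \<open>offspring_pgf_upto\<close>.
\<close>

lemma offspring_pgf_upto_LIMSEQ:
  assumes x: "\<And>n. x n \<in> {0..1}" and lim: "x \<longlonglongrightarrow> z"
  shows "(\<lambda>n. offspring_pgf_upto g b c (Suc n) (x n)) \<longlonglongrightarrow> expectation (\<lambda>\<omega>. z ^ offspring \<omega>)"
proof -
  have ptw: "(\<lambda>n. x n ^ offspring \<omega> * short (Suc n) \<omega>) \<longlonglongrightarrow> z ^ offspring \<omega>" if "\<omega> \<in> space M" for \<omega>
    using tendsto_mult[OF tendsto_power[OF lim] short_LIMSEQ[OF that]] by simp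
  have meas: "(\<lambda>\<omega>. x n ^ offspring \<omega> * short (Suc n) \<omega>) \<in> borel_measurable M" for n
    using x[of n] by (intro offspring_measurable) auto
  have "(\<lambda>n. expectation (\<lambda>\<omega>. x n ^ offspring \<omega> * short (Suc n) \<omega>)) \<longlonglongrightarrow> expectation (\<lambda>\<omega>. z ^ offspring \<omega>)"
  proof (rule integral_dominated_convergence[where w = "\<lambda>_. 1"])
    show "(\<lambda>\<omega>. z ^ offspring \<omega>) \<in> borel_measurable M"
      by (rule borel_measurable_LIMSEQ_real[OF ptw meas])
    show "AE \<omega> in M. norm (x n ^ offspring \<omega> * short (Suc n) \<omega>) \<le> 1" for n
      unfolding real_norm_def using x[of n] by (intro AE_I2 offspring_bounded) auto
  qed (use meas ptw in \<open>auto intro: AE_I2\<close>)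
  then show ?thesis
    using x by (simp add: offspring_pgf_upto_eq)
qed

lemma offspring_pgf_upto_mono:
  assumes "0 \<le> x" "x \<le> y" "y \<le> 1" "0 < S" "S \<le> T"
  shows "offspring_pgf_upto g b c S x \<le> offspring_pgf_upto g b c T y"
proof -
  have "expectation (\<lambda>\<omega>. x ^ offspring \<omega> * short S \<omega>) \<le> expectation (\<lambda>\<omega>. y ^ offspring \<omega> * short T \<omega>)"
  proof (rule integral_mono)
    show "x ^ offspring \<omega> * short S \<omega> \<le> y ^ offspring \<omega> * short T \<omega>" for \<omega>
      using assms by (auto intro!: power_mono simp: indicator_def)
  qed (rule offspring_integrable; use assms in simp)+
  then show ?thesis using assms by (simp add: offspring_pgf_upto_eq)
qed

lemma offspring_pgf_upto_bounds:
  assumes "0 \<le> x" "x \<le> 1" "0 < T"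
  shows "0 \<le> offspring_pgf_upto g b c T x"
  using assms by (simp add: offspring_pgf_upto_eq)

text \<open>
  A life span exceeds any given bound with positive probability.
\<close>

lemma offspring_pgf_upto_1_less:
  "offspring_pgf_upto g b c T 1 < 1"
  by (simp add: offspring_pgf_upto_def survival_pgf_def)

lemma continuous_on_offspring_pgf_upto:
  assumes T: "0 < T"
  shows "continuous_on {0..1} (offspring_pgf_upto g b c T)"
  unfolding continuous_on_sequentially
proof (intro allI ballI impI)
  fix x :: "nat \<Rightarrow> real" and z :: real
  assume z: "z \<in> {0..1}" and x: "(\<forall>n. x n \<in> {0..1}) \<and> x \<longlonglongrightarrow> z"
  have "(\<lambda>n. expectation (\<lambda>\<omega>. x n ^ offspring \<omega> * short T \<omega>)) \<longlonglongrightarrow> expectation (\<lambda>\<omega>. z ^ offspring \<omega> * short T \<omega>)"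
  proof (rule integral_dominated_convergence[where w = "\<lambda>_. 1"])
    show "AE \<omega> in M. norm (x n ^ offspring \<omega> * short T \<omega>) \<le> 1" for n
      unfolding real_norm_def using x by (intro AE_I2 offspring_bounded) auto
    show "AE \<omega> in M. (\<lambda>n. x n ^ offspring \<omega> * short T \<omega>) \<longlonglongrightarrow> z ^ offspring \<omega> * short T \<omega>"
      using x by (intro AE_I2 tendsto_intros) auto
  qed (use x z T in \<open>auto intro: offspring_measurable\<close>)
  then show "(offspring_pgf_upto g b c T \<circ> x) \<longlonglongrightarrow> offspring_pgf_upto g b c T z"
    using x z T by (simp add: comp_def offspring_pgf_upto_eq)
qed

lemma offspring_pgf_upto_convex:
  assumes a: "a \<in> {0..1}" and d: "d \<in> {0..1}" and T: "0 < T"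
  shows "offspring_pgf_upto g b c T (a * d + (1 - a))
       \<le> a * offspring_pgf_upto g b c T d + (1 - a) * offspring_pgf_upto g b c T 1"
proof -
  have ad: "0 \<le> a * d + (1 - a)" "a * d + (1 - a) \<le> 1"
    using a d mult_left_le[of d a] by auto
  have "expectation (\<lambda>\<omega>. (a * d + (1 - a)) ^ offspring \<omega> * short T \<omega>)
      \<le> expectation (\<lambda>\<omega>. a * (d ^ offspring \<omega> * short T \<omega>) + (1 - a) * (1 ^ offspring \<omega> * short T \<omega>))"
  proof (rule integral_mono)
    fix \<omega>
    show "(a * d + (1 - a)) ^ offspring \<omega> * short T \<omega>
        \<le> a * (d ^ offspring \<omega> * short T \<omega>) + (1 - a) * (1 ^ offspring \<omega> * short T \<omega>)"
      using power_convex_combination_one[of d a "offspring \<omega>"] a d by (auto simp: indicator_def)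
  qed (intro offspring_integrable Bochner_Integration.integrable_add integrable_mult_right; use ad a d T in auto)+
  also have "\<dots> = a * expectation (\<lambda>\<omega>. d ^ offspring \<omega> * short T \<omega>) + (1 - a) * expectation (\<lambda>\<omega>. 1 ^ offspring \<omega> * short T \<omega>)"
    using offspring_integrable[of d T] offspring_integrable[of 1 T] d T by simp
  finally show ?thesis using ad a d T by (simp add: offspring_pgf_upto_eq)
qed

text \<open>
  The extinction probability is the limit of the fixed points \<open>r T\<close> of the truncated generating functions.
\<close>

theorem prob_extinct_least_fixpoint:
  defines "q \<equiv> prob {\<omega> \<in> space M. extinct \<omega>}"
  shows "expectation (\<lambda>\<omega>. q ^ offspring \<omega>) = q"
    and "z \<in> {0..1} \<Longrightarrow> expectation (\<lambda>\<omega>. z ^ offspring \<omega>) = z \<Longrightarrow> q \<le> z"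
proof -
  define h where "h T = offspring_pgf_upto g b c (real (Suc T))" for T
  have h_mono: "h S x \<le> h T y" if "S \<le> T" "0 \<le> x" "x \<le> y" "y \<le> 1" for S T x y
    unfolding h_def using that by (intro offspring_pgf_upto_mono) auto
  have "\<exists>r. r \<in> {0..1} \<and> h T r = r \<and> (\<lambda>n. (h T ^^ n) 0) \<longlonglongrightarrow> r \<and> (\<lambda>n. (h T ^^ n) 1) \<longlonglongrightarrow> r" for T
  proof (rule iterates_converge_to_unique_fixpoint)
    show "continuous_on {0..1} (h T)"
      unfolding h_def by (rule continuous_on_offspring_pgf_upto) simp
    show "h T (a * d + (1 - a)) \<le> a * h T d + (1 - a) * h T 1" if "a \<in> {0..1}" "d \<in> {0..1}" for a d
      unfolding h_def by (rule offspring_pgf_upto_convex[OF that]) simp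
    show "0 \<le> h T 0"
      unfolding h_def by (rule offspring_pgf_upto_bounds) simp_all
    show "h T 1 < 1"
      unfolding h_def by (rule offspring_pgf_upto_1_less)
  qed (use h_mono in blast)+
  then obtain r where r01: "\<And>T. r T \<in> {0..1}" and r_fix: "\<And>T. h T (r T) = r T"
    and r0: "\<And>T. (\<lambda>n. (h T ^^ n) 0) \<longlonglongrightarrow> r T" and r1: "\<And>T. (\<lambda>n. (h T ^^ n) 1) \<longlonglongrightarrow> r T"
    by metis
  have le_q: "r T \<le> q" for T
    by (rule LIMSEQ_le_const2[OF r0])
       (use iterate_le_prob_extinct[of "real (Suc T)"] in \<open>auto simp: h_def q_def\<close>)
  have q_le: "q \<le> y" if "\<And>T. r T \<le> y" for y
    unfolding q_def by (rule prob_extinct_le[where r = r]) (use r1 that in \<open>auto simp: h_def\<close>)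
  have it: "(h T ^^ n) 0 \<in> {0..1}" for T n
  proof (induction n)
    case (Suc n)
    have "h T 0 \<le> h T ((h T ^^ n) 0)" "h T ((h T ^^ n) 0) \<le> h T 1"
      using Suc by (auto intro: h_mono)
    moreover have "0 \<le> h T 0" unfolding h_def by (rule offspring_pgf_upto_bounds) simp_all
    moreover have "h T 1 < 1" unfolding h_def by (rule offspring_pgf_upto_1_less)
    ultimately show ?case by simp
  qed simp
  have "r T \<le> r (Suc T)" for T
  proof (rule LIMSEQ_le[OF r0 r0])
    have "(h T ^^ n) 0 \<le> (h (Suc T) ^^ n) 0" for n
    proof (induction n)
      case (Suc n)
      then show ?case using it[of n T] it[of n "Suc T"] by (simp add: h_mono)
    qed simp
    then show "\<exists>N. \<forall>n\<ge>N. (h T ^^ n) 0 \<le> (h (Suc T) ^^ n) 0" by blast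
  qed
  then have "incseq r" by (rule incseq_SucI)
  then obtain l where l: "r \<longlonglongrightarrow> l" "\<And>T. r T \<le> l"
    using incseq_convergent[of r 1] r01 by auto
  have "l = q"
    using q_le[OF l(2)] LIMSEQ_le_const2[OF l(1)] le_q by (meson order_antisym)
  \<comment> \<open>Both sides of \<open>h T (r T) = r T\<close> converge.\<close>
  have "(\<lambda>T. h T (r T)) \<longlonglongrightarrow> expectation (\<lambda>\<omega>. q ^ offspring \<omega>)"
    using offspring_pgf_upto_LIMSEQ[OF r01 l(1)] \<open>l = q\<close> by (simp add: h_def)
  then show "expectation (\<lambda>\<omega>. q ^ offspring \<omega>) = q"
    unfolding r_fix using l(1) \<open>l = q\<close> LIMSEQ_unique by blast
  assume z: "z \<in> {0..1}" "expectation (\<lambda>\<omega>. z ^ offspring \<omega>) = z"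
  show "q \<le> z"
  proof (rule q_le)
    fix T
    have "h T z \<le> z"
    proof (rule LIMSEQ_le_const)
      show "(\<lambda>n. h n z) \<longlonglongrightarrow> z"
        using offspring_pgf_upto_LIMSEQ[of "\<lambda>_. z" z] z by (simp add: h_def)
      show "\<exists>N. \<forall>n\<ge>N. h T z \<le> h n z" using z(1) h_mono[of T _ z z] by auto
    qed
    have "(h T ^^ n) 0 \<le> z" for n
    proof (induction n)
      case (Suc n)
      then have "h T ((h T ^^ n) 0) \<le> h T z" using it[of n T] z(1) by (intro h_mono) auto
      with \<open>h T z \<le> z\<close> show ?case by simp
    qed (use z in simp)
    then show "r T \<le> z" by (intro LIMSEQ_le_const2[OF r0]) auto
  qed
qed

end


section \<open>The integral formula\<close>

lemma continuous_on_scaled_quotient: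
  fixes g :: "real \<Rightarrow> real"
  assumes g: "continuous_on {0..1} g" and z: "0 \<le> z" "z \<le> 1" and l: "0 < l"
  shows "continuous_on {l..1} (\<lambda>v. g (v * z) / v)"
  using l z by (auto intro!: continuous_intros continuous_on_compose2[OF g] mult_le_one)

text \<open>
  The substitution \<open>v = exp (- c (t - s))\<close>.
\<close>

lemma survival_pgf_eq:
  fixes g :: "real \<Rightarrow> real" and b c z t :: real
  assumes g: "continuous_on {0..1} g" and z: "0 \<le> z" "z \<le> 1" and c: "0 < c" and t: "0 \<le> t"
  shows "survival_pgf g b c z t = exp (1 / c * (LBINT v=exp (- c * t)..1. g (v * z) / v) - (1 + b) * t)"
proof -
  let ?e = "\<lambda>s. exp (- c * (t - s))"
  note cont = continuous_on_scaled_quotient[OF g z]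
  have img: "?e ` {0..t} \<subseteq> {exp (- c * t)..1}" using c by (auto simp: mult_left_mono)
  have deriv: "(?e has_real_derivative c * ?e s) (at s within {0..t})" for s
    by (auto intro!: derivative_eq_intros)
  have "(LBINT s=0..t. (c * ?e s) *\<^sub>R (g (?e s * z) / ?e s)) = (LBINT v=?e 0..?e t. g (v * z) / v)"
    by (rule interval_integral_substitution_finite[OF t deriv, unfolded zero_ereal_def[symmetric]])
       (use continuous_on_subset[OF cont img] in \<open>auto intro!: continuous_intros\<close>)
  also have "(LBINT s=0..t. (c * ?e s) *\<^sub>R (g (?e s * z) / ?e s)) = (LBINT s=0..t. c * g (z * ?e s))"
    by (rule interval_integral_cong) (simp add: mult.commute)
  finally have 1: "c * (LBINT s=0..t. g (z * ?e s)) = (LBINT v=exp (- c * t)..1. g (v * z) / v)"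
    by (simp add: one_ereal_def)
  have "continuous_on {0..t} (\<lambda>s. g (z * ?e s))"
    using z c by (auto intro!: continuous_intros continuous_on_compose2[OF g] mult_le_one)
  from interval_integrable_continuous_on[OF t this]
  have "(LBINT s=0..t. g (z * ?e s) - 1) = (LBINT s=0..t. g (z * ?e s)) - t"
    by (subst interval_lebesgue_integral_diff) (auto simp: zero_ereal_def)
  also have "\<dots> = 1 / c * (LBINT v=exp (- c * t)..1. g (v * z) / v) - t"
    unfolding 1[symmetric] using c by simp
  finally show ?thesis unfolding survival_pgf_def by (simp add: algebra_simps)
qed

text \<open>
  The substitution \<open>u = exp (- c t)\<close>.
\<close>

lemma integral_survival_pgf:
  fixes g :: "real \<Rightarrow> real" and b c z T :: real
  assumes g: "continuous_on {0..1} g" and z: "0 \<le> z" "z \<le> 1" and c: "0 < c" and T: "0 \<le> T"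
  defines "\<psi> \<equiv> \<lambda>u. u powr ((1 + b) / c - 1) * exp (1 / c * (LBINT v=u..1. g (v * z) / v))"
  shows "continuous_on {exp (- c * T)..1} \<psi>"
    and "c * (LBINT t=0..T. survival_pgf g b c z t) = (LBINT u=exp (- c * T)..1. \<psi> u)"
proof -
  let ?l = "exp (- c * T)" and ?e = "\<lambda>t. exp (- c * t)"
  have l: "0 < ?l" "?l \<le> 1" using c T by auto
  note cont = continuous_on_scaled_quotient[OF g z l(1)]
  have "continuous_on {?l..1} (\<lambda>u. LBINT v=1..u. g (v * z) / v)"
    by (rule continuous_on_vector_derivative)
       (rule interval_integral_FTC2[OF l(2) order_refl cont, unfolded one_ereal_def[symmetric]], auto)
  then have J: "continuous_on {?l..1} (\<lambda>u. LBINT v=u..1. g (v * z) / v)"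
    by (subst interval_integral_endpoints_reverse) (intro continuous_intros)
  have pos: "0 < u" if "u \<in> {?l..1}" for u using less_le_trans[OF l(1), of u] that by simp
  show cont_\<psi>: "continuous_on {?l..1} \<psi>"
    unfolding \<psi>_def by (intro continuous_intros J) (use pos in auto)
  have img: "?e ` {0..T} \<subseteq> {?l..1}" using c by (auto simp: mult_left_mono)
  have deriv: "(?e has_real_derivative - c * ?e t) (at t within {0..T})" for t
    by (auto intro!: derivative_eq_intros)
  have "(LBINT t=0..T. (- c * ?e t) *\<^sub>R \<psi> (?e t)) = (LBINT u=?e 0..?e T. \<psi> u)"
    by (rule interval_integral_substitution_finite[OF T deriv, unfolded zero_ereal_def[symmetric]])
       (use continuous_on_subset[OF cont_\<psi> img] in \<open>auto intro!: continuous_intros\<close>)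
  also have "\<dots> = - (LBINT u=?l..1. \<psi> u)"
    by (subst interval_integral_endpoints_reverse) (simp add: one_ereal_def)
  also have "(LBINT t=0..T. (- c * ?e t) *\<^sub>R \<psi> (?e t)) = (LBINT t=0..T. - c * survival_pgf g b c z t)"
  proof (rule interval_integral_cong)
    fix t assume "t \<in> einterval (min 0 (ereal T)) (max 0 (ereal T))"
    then have t: "0 \<le> t" using T by (auto simp: einterval_def min_def zero_ereal_def split: if_splits)
    let ?J = "1 / c * (LBINT v=?e t..1. g (v * z) / v)"
    have powr: "?e t * ?e t powr ((1 + b) / c - 1) = exp (- (1 + b) * t)"
      using c by (simp add: powr_def mult_exp_exp field_simps)
    have "(- c * ?e t) *\<^sub>R \<psi> (?e t) = - c * ((?e t * ?e t powr ((1 + b) / c - 1)) * exp ?J)"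
      by (simp add: \<psi>_def)
    also have "\<dots> = - c * exp (?J - (1 + b) * t)"
      unfolding powr mult_exp_exp by (simp add: algebra_simps)
    finally show "(- c * ?e t) *\<^sub>R \<psi> (?e t) = - c * survival_pgf g b c z t"
      unfolding survival_pgf_eq[OF g z c t] .
  qed
  also have "\<dots> = - c * (LBINT t=0..T. survival_pgf g b c z t)"
    by (rule interval_lebesgue_integral_mult_right)
  finally show "c * (LBINT t=0..T. survival_pgf g b c z t) = (LBINT u=?l..1. \<psi> u)"
    by simp
qed

text \<open>
  The integrand may be unbounded near 0, so the integral over the unit interval is obtained by monotone convergence.
\<close>

lemma LBINT_unit_interval_eqI:
  fixes f :: "real \<Rightarrow> real"
  assumes cont: "\<And>n. continuous_on {l n..1} f" and nonneg: "\<And>u. 0 \<le> f u"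
    and l: "decseq l" "l \<longlonglongrightarrow> 0" "\<And>n. 0 < l n" "\<And>n. l n \<le> 1"
    and lim: "(\<lambda>n. LBINT u=l n..1. f u) \<longlonglongrightarrow> C"
  shows "(LBINT u=0..1. f u) = C"
proof -
  have eq: "(LBINT u=a..1. f u) = (\<integral>u. indicator {a<..<1} u * f u \<partial>lborel)" if "a \<le> 1" for a :: real
    using that by (simp add: interval_lebesgue_integral_def set_lebesgue_integral_def einterval_eq one_ereal_def)
  have lim_ptw: "(\<lambda>n. indicator {l n<..<1} u * f u) \<longlonglongrightarrow> indicator {0<..<1} u * f u" for u :: real
  proof (cases "0 < u")
    case True
    have "\<forall>\<^sub>F n in sequentially. l n < u" using order_tendstoD(2)[OF l(2) True] .
    then have "\<forall>\<^sub>F n in sequentially. indicator {l n<..<1} u * f u = indicator {0<..<1} u * f u"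
      by eventually_elim (use True in \<open>auto simp: indicator_def\<close>)
    then show ?thesis by (rule tendsto_eventually)
  next
    case False
    then have "indicator {l n<..<1} u * f u = indicator {0<..<1} u * f u" for n
      using l(3)[of n] by (auto simp: indicator_def)
    then show ?thesis by (simp only: tendsto_const)
  qed
  have int: "integrable lborel (\<lambda>u. indicator {l n<..<1} u * f u)" for n
  proof -
    have "set_integrable lborel {l n..1} f"
      by (rule borel_integrable_atLeastAtMost'[OF cont])
    then have "set_integrable lborel {l n<..<1} f"
      by (rule set_integrable_subset) auto
    then show ?thesis by (simp add: set_integrable_def)
  qed
  have "(\<integral>u. indicator {0<..<1} u * f u \<partial>lborel) = C"
  proof (rule integral_monotone_convergence[OF int])
    show "AE u in lborel. mono (\<lambda>n. indicator {l n<..<1} u * f u)"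
      using l(1) nonneg by (intro AE_I2 monoI) (auto simp: indicator_def decseq_def intro: le_less_trans)
    show "(\<lambda>n. \<integral>u. indicator {l n<..<1} u * f u \<partial>lborel) \<longlonglongrightarrow> C"
      using lim l(4) by (simp add: eq)
    show "(\<lambda>u. indicator {0<..<1} u * f u) \<in> borel_measurable lborel"
      by (rule borel_measurable_LIMSEQ_real[OF lim_ptw]) (rule borel_measurable_integrable[OF int])
  qed (use lim_ptw in auto)
  then show ?thesis using eq[of 0] by (simp add: zero_ereal_def)
qed

context random_cherry_tree_pos
begin

lemma survival_pgf_LIMSEQ:
  assumes z: "0 \<le> z" "z \<le> 1"
  shows "(\<lambda>n. survival_pgf g b c z (Suc n)) \<longlonglongrightarrow> 0"
proof (rule tendsto_sandwich[OF _ _ tendsto_const])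
  have "survival_pgf g b c z t \<le> exp (- b * t)" if "0 \<le> t" for t
  proof -
    have "0 \<le> (LBINT s=0..t. 1 - g (z * exp (- c * (t - s))))"
      unfolding interval_lebesgue_integral_def set_lebesgue_integral_def
      using that z c_pos
      by (auto intro!: Bochner_Integration.integral_nonneg gen_fun_le_1 mult_le_one
          simp: einterval_def indicator_def zero_ereal_def)
    moreover have "(LBINT s=0..t. g (z * exp (- c * (t - s))) - 1) = - (LBINT s=0..t. 1 - g (z * exp (- c * (t - s))))"
      by (subst interval_lebesgue_integral_uminus[symmetric]) simp
    ultimately show ?thesis unfolding survival_pgf_def by simp
  qed
  then show "\<forall>\<^sub>F n in sequentially. survival_pgf g b c z (Suc n) \<le> exp (- b * Suc n)"
    by simp
  have "(\<lambda>n. exp (- b) ^ Suc n) \<longlonglongrightarrow> 0"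
    using b_pos by (intro LIMSEQ_Suc LIMSEQ_power_zero) simp
  then show "(\<lambda>n. exp (- b * Suc n)) \<longlonglongrightarrow> 0"
    by (simp only: exp_of_nat_mult[symmetric] mult.commute)
qed (simp add: survival_pgf_def)

text \<open>
  As \<open>T\<close> tends to infinity, the survival term of \<open>offspring_pgf_upto\<close> vanishes and its integral becomes
  the one over the unit interval.
\<close>

theorem offspring_pgf_formula:
  assumes z: "0 \<le> z" "z \<le> 1"
  shows "(1 - g z) / c * (LBINT u=0..1. u powr ((1 + b) / c - 1) * exp (1 / c * (LBINT v=u..1. g (v * z) / v)))
       = 1 - expectation (\<lambda>\<omega>. z ^ offspring \<omega>)"
proof -
  define \<psi> where "\<psi> u = u powr ((1 + b) / c - 1) * exp (1 / c * (LBINT v=u..1. g (v * z) / v))" for u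
  define G where "G = expectation (\<lambda>\<omega>. z ^ offspring \<omega>)"
  define I where "I n = (LBINT t=0..real (Suc n). survival_pgf g b c z t)" for n
  note int = integral_survival_pgf[OF continuous_on_gen_fun[of "eps_pmf \<kappa> p"] z c_pos, where b = b, folded \<psi>_def]
  have "(\<lambda>n. offspring_pgf_upto g b c (Suc n) z) \<longlonglongrightarrow> G"
    unfolding G_def by (rule offspring_pgf_upto_LIMSEQ) (use z in auto)
  then have "(\<lambda>n. 1 - survival_pgf g b c z (Suc n) - offspring_pgf_upto g b c (Suc n) z) \<longlonglongrightarrow> 1 - 0 - G"
    by (intro tendsto_diff tendsto_const survival_pgf_LIMSEQ[OF z])
  then have lim: "(\<lambda>n. (1 - g z) * I n) \<longlonglongrightarrow> 1 - G"
    by (simp add: offspring_pgf_upto_def I_def)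
  have "(1 - g z) / c * (LBINT u=0..1. \<psi> u) = 1 - G"
  \<comment> \<open>If \<open>g z = 1\<close>, then both sides are 0; otherwise the integrals converge by \<open>lim\<close>.\<close>
  proof (cases "g z = 1")
    case True
    then show ?thesis using LIMSEQ_unique[OF lim, of 0] by simp
  next
    case False
    have "(\<lambda>n. c * ((1 - g z) * I n / (1 - g z))) \<longlonglongrightarrow> c * ((1 - G) / (1 - g z))"
      by (intro tendsto_intros lim) (use False in simp)
    then have "(\<lambda>n. LBINT u=exp (- c * Suc n)..1. \<psi> u) \<longlonglongrightarrow> c * ((1 - G) / (1 - g z))"
      using False int(2)[of "real (Suc n)" for n] by (simp add: I_def)
    then have "(LBINT u=0..1. \<psi> u) = c * ((1 - G) / (1 - g z))"
    proof (rule LBINT_unit_interval_eqI[rotated -1])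
      show "continuous_on {exp (- c * Suc n)..1} \<psi>" for n by (rule int(1)) simp
      show "decseq (\<lambda>n. exp (- c * Suc n))" using c_pos by (simp add: decseq_Suc_iff)
      have "(\<lambda>n. exp (- c) ^ Suc n) \<longlonglongrightarrow> 0"
        using c_pos by (intro LIMSEQ_Suc LIMSEQ_power_zero) simp
      then show "(\<lambda>n. exp (- c * Suc n)) \<longlonglongrightarrow> 0"
        by (simp only: exp_of_nat_mult[symmetric] mult.commute)
    qed (use c_pos in \<open>auto simp: \<psi>_def\<close>)
    then show ?thesis using False c_pos by simp
  qed
  then show ?thesis by (simp add: \<psi>_def G_def)
qed

end

text \<open>
  In the unit interval the equation is the fixed point equation of the offspring generating function, and
  roots above 1 exceed every probability.
\<close>

theorem corollary3p9:
  fixes M :: "'a measure" and b c p :: real and \<kappa> :: "nat pmf"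
    and \<pi> :: "edge \<Rightarrow> real \<Rightarrow> 'a \<Rightarrow> nat"
    and K :: "edge \<Rightarrow> nat \<Rightarrow> 'a \<Rightarrow> nat"
    and \<phi> :: "edge \<Rightarrow> nat \<Rightarrow> nat \<Rightarrow> 'a \<Rightarrow> nat"
    and s :: "edge \<Rightarrow> nat \<Rightarrow> nat \<Rightarrow> 'a \<Rightarrow> bool"
    and L :: "edge \<Rightarrow> 'a \<Rightarrow> real"
  defines "g \<equiv> gen_fun (eps_pmf \<kappa> p)"
  defines "R \<equiv> {z :: real. 0 \<le> z \<and>
      (1 - g z) / c * (LBINT u=0..1. u powr ((1 + b) / c - 1) *
         exp (1 / c * (LBINT v=u..1. g (v * z) / v))) = 1 - z}"
  defines "q \<equiv> measure M {\<omega> \<in> space M. cherry_data.extinct \<pi> K \<phi> s L \<omega>}"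
  assumes "0 < b" and "0 < c" and "p \<in> {0..1}"
    and "0 \<notin> set_pmf \<kappa>"
    and "\<And>z :: real. integrable (measure_pmf \<kappa>) (\<lambda>k. z ^ k)"
    and "random_cherry_tree M b c p \<kappa> \<pi> K \<phi> s L"
    and "measure_pmf.expectation (eps_pmf \<kappa> p) real / c *
         (LBINT u=0..1. u powr ((1 + b) / c - 1) *
            exp (1 / c * (LBINT v=u..1. g v / v))) > 1"
  shows "q \<in> R \<and> (\<forall>z\<in>R. q \<le> z)"
proof -
  interpret random_cherry_tree_pos M b c p \<kappa> \<pi> K \<phi> s L
    using assms by (intro random_cherry_tree_pos.intro random_cherry_tree_pos_axioms.intro)
  have R_iff: "z \<in> R \<longleftrightarrow> expectation (\<lambda>\<omega>. z ^ offspring \<omega>) = z" if "0 \<le> z" "z \<le> 1" for z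
    unfolding R_def g_def mem_Collect_eq offspring_pgf_formula[OF that] using that by auto
  have q: "0 \<le> q" "q \<le> 1" unfolding q_def by simp_all
  show ?thesis
  proof (intro conjI ballI)
    show "q \<in> R"
      unfolding R_iff[OF q] unfolding q_def by (rule prob_extinct_least_fixpoint(1))
    fix z assume z: "z \<in> R"
    then have "0 \<le> z" by (simp add: R_def)
    show "q \<le> z"
    proof (cases "z \<le> 1")
      case True
      then show ?thesis
        using z R_iff[OF \<open>0 \<le> z\<close> True] \<open>0 \<le> z\<close> unfolding q_def
        by (intro prob_extinct_least_fixpoint(2)) auto
    qed (use q in simp)
  qed
qed

end
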